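(* Consider binary floating-point arithmetic with precision $p\ge 5$ and unit round-off $u=2^{-p}$, all operations correctly rounded to nearest ($\mathrm{RN}$), an FMA available, and no underflow or overflow. Let $R_2=\mathrm{RN}(\sqrt2)$, $P_h=\mathrm{RN}(1+\sqrt2)$, $P_\ell=\mathrm{RN}(1+\sqrt2-P_h)$. For floating-point inputs $0\le y\le x$ consider the algorithm: $\delta\gets\mathrm{RN}(x-y)$. If $\delta>y$: $r\gets\mathrm{RN}(x/y)$, $t\gets\mathrm{RN}(1+r^2)$, $s\gets\mathrm{RN}(\sqrt t)$, $z\gets\mathrm{RN}(r+s)$. Otherwise: $r_2\gets\mathrm{RN}(\delta/y)$, $tr_2\gets\mathrm{RN}(2r_2)$, $r_3\gets\mathrm{RN}(tr_2+r_2^2)$ (one FMA, single rounding), $r_4\gets\mathrm{RN}(2+r_3)$, $s_2\gets\mathrm{RN}(\sqrt{r_4})$, $d\gets\mathrm{RN}(R_2+s_2)$, $q\gets\mathrm{RN}(r_3/d)$, $r_5\gets\mathrm{RN}(P_\ell+q)$, $r_6\gets\mathrm{RN}(r_5+r_2)$, $z\gets\mathrm{RN}(P_h+r_6)$. Finally, in both cases, $z_2\gets\mathrm{RN}(y/z)$ and $\rho_5\gets\mathrm{RN}(x+z_2)$. Then the relative error $|\rho_5/\sqrt{x^2+y^2}-1|$ is bounded by \[ \phi(u) = \frac{\left(1+\dfrac{1+u(1-2u)}{1+\sqrt2-\frac{u(2+u)(1+2u)^2}{(1+u)^2}}\right)(1+2u)}{\left(1+\frac{1}{1+\sqrt2}\right)(1+u)}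 - 1, \] which satisfies $\phi(u) = \left(\frac{5\sqrt2}{2}-2\right)u + \left(30-\frac{39\sqrt2}{2}\right)u^3 + O(u^4)$ and $\phi(u)\le \left(\frac{5\sqrt2}{2}-2\right)u + \frac{u^2}{12}$ for $0\le u\le 1/32$.
   Context: A radix-2 floating-point number of precision $p$ has the form $M\cdot 2^{e-p+1}$ with integers $|M|\le 2^p-1$ and $e_{\min}\le e\le e_{\max}$. $\mathrm{RN}$ is rounding to nearest (ties-to-even). An FMA computes $\mathrm{RN}(ab+c)$ with a single rounding. "No underflow or overflow" means all nonzero intermediate results lie in the normal range. *)

theory Defs
  imports Complex_Main "HOL-Library.Landau_Symbols"
begin

text \<open>Radix-2 floating-point numbers of precision p with unbounded exponent range
  (this models the standing hypothesis "no underflow or overflow").\<close>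

definition is_float :: "nat \<Rightarrow> real \<Rightarrow> bool" where
  "is_float p x \<longleftrightarrow> (\<exists>(M::int) (e::int). x = of_int M * 2 powr of_int e \<and> \<bar>M\<bar> \<le> 2 ^ p - 1)"

definition round_even :: "real \<Rightarrow> int" where
  "round_even m = (let f = \<lfloor>m\<rfloor>; d = m - of_int f in
     if d < 1/2 then f else if d > 1/2 then f + 1 else if even f then f else f + 1)"

text \<open>RN: rounding to nearest precision-p float, ties to even (unbounded exponents).
  For x \<noteq> 0 with 2^e \<le> |x| < 2^(e+1), the float grid near x has spacing 2^(e-p+1).\<close>
definition RN :: "nat \<Rightarrow> real \<Rightarrow> real" where
  "RN p x = (if x = 0 then 0 else
     (let e = \<lfloor>log 2 \<bar>x\<bar>\<rfloor>; ulp = 2 powr of_int (e - int p + 1)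
      in of_int (round_even (x / ulp)) * ulp))"

text \<open>The hypot algorithm; every operation is correctly rounded, the computation of
  r3 is one FMA (single rounding).\<close>
definition hypot_alg :: "nat \<Rightarrow> real \<Rightarrow> real \<Rightarrow> real" where
  "hypot_alg p x y =
    (let fl = RN p;
         R2 = fl (sqrt 2);
         Ph = fl (1 + sqrt 2);
         Pl = fl (1 + sqrt 2 - Ph);
         \<delta> = fl (x - y);
         z = (if \<delta> > y then
                (let r = fl (x / y); t = fl (1 + r ^ 2); s = fl (sqrt t) in fl (r + s))
              else
                (let r2 = fl (\<delta> / y); tr2 = fl (2 * r2); r3 = fl (tr2 + r2 ^ 2);
                     r4 = fl (2 + r3); s2 = fl (sqrt r4); d = fl (R2 + s2);
                     q = fl (r3 / d); r5 = fl (Pl + q); r6 = fl (r5 + r2)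
                 in fl (Ph + r6)));
         z2 = fl (y / z)
     in fl (x + z2))"

definition phi :: "real \<Rightarrow> real" where
  "phi u = ((1 + (1 + u * (1 - 2 * u)) /
               (1 + sqrt 2 - u * (2 + u) * (1 + 2 * u) ^ 2 / (1 + u) ^ 2)) * (1 + 2 * u))
           / ((1 + 1 / (1 + sqrt 2)) * (1 + u)) - 1"

end

theory Submission
  imports Defs
begin

text \<open>
  Put \<open>r = x / y\<close> and \<open>h = sqrt (1 + r\<^sup>2)\<close>. Since \<open>sqrt (x\<^sup>2 + y\<^sup>2) = x + y / (r + h)\<close>, the error
  is governed by the last addition, the last division, whose error is at most \<open>u - 2 * u\<^sup>2\<close>, and
  the error of \<open>z\<close> as an approximation of \<open>r + h\<close>. Writing \<open>phi u = (1 + u / (1 + u)) (1 + X / G) - 1\<close>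
  with \<open>G = 2 + sqrt 2\<close> the value of \<open>h * (r + h)\<close> at \<open>r = 1\<close>, the bound \<open>phi u\<close> becomes a pair of
  rational inequalities on \<open>z\<close>. The lower one is attained at \<open>r = 1\<close> when \<open>z\<close> is too small by
  \<open>E = u (2 + u) (1 + 2 u)\<^sup>2 / (1 + u)\<^sup>2\<close>. For \<open>r > 2\<close> plain relative error bounds suffice. For
  \<open>r = 1 + w\<close> with \<open>0 \<le> w \<le> 1\<close> the subtraction is exact, the error of \<open>z\<close> is at most
  \<open>E + c * u * w\<close> with \<open>c\<close> about \<open>6.712\<close>, and the inequality tolerates about \<open>6.742 * u * w\<close>.
\<close>

section \<open>Rounding to nearest\<close>

text \<open>The weight \<open>h * (r + h)\<close> enters because y / (r + h) is the fraction 1 / (h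
  (r + h)) of the exact hypotenuse: a relative error X of the quotient costs only X / (h (r + h)) of
  the result. This weight improves as r leaves 1, and that gain has to pay for the error of z that
  grows with w. The obstacle is that the lower inequality has no slack at w = 0, and only 0.03 u w
  next to it. For u up to 1/32, terms u^2 w with coefficients above 12 outweigh this margin.
  Second-order savings must therefore be carried along on the lower side: u / (1 + u) instead of u
  for a rounding, u - 2 u^2 for a quotient of floats, and the exact constant E at w = 0. The upper
  inequality is looser by a factor 1 + 2 u, because rounding a result that is already too small
  removes a fraction of a smaller number; there crude second-order bounds do. Most decimal constants
  below are first-order coefficients rounded in the safe direction, with as many digits as the
  margin demands.\<close>

lemma is_float_intro:
  fixes M e :: int
  assumes "p \<ge> 1" and "\<bar>M\<bar> \<le> 2 ^ p"
  shows "is_float p (of_int M * 2 powr of_int e)"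
proof (cases "\<bar>M\<bar> = 2 ^ p")
  case False
  then show ?thesis using assms unfolding is_float_def by (intro exI[of _ M] exI[of _ e]) auto
next
  case True
  \<comment> \<open>This is the carry after rounding up: the significand 2^p or -2^p becomes 1 or
    -1, with the exponent raised by p.\<close>
  have "(2::int) ^ 1 \<le> 2 ^ p" using assms(1) by (rule power_increasing) simp
  moreover have "of_int M = real_of_int (sgn M) * 2 powr of_int (int p)"
    using True by (cases "M \<ge> 0") (auto simp: sgn_if powr_realpow dest!: arg_cong[where f = real_of_int])
  ultimately show ?thesis
    unfolding is_float_def
    by (intro exI[of _ "sgn M"] exI[of _ "int p + e"]) (auto simp: powr_add sgn_if)
qed

lemma is_float_of_int:
  assumes "p \<ge> 1" and "\<bar>M\<bar> \<le> 2 ^ p"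
  shows "is_float p (of_int M)"
  using is_float_intro[OF assms, of 0] by simp

lemma is_float_mult_powr:
  assumes "is_float p x"
  shows "is_float p (x * 2 powr of_int e)"
proof -
  obtain M k :: int where "x = of_int M * 2 powr of_int k" "\<bar>M\<bar> \<le> 2 ^ p - 1"
    using assms unfolding is_float_def by auto
  then show ?thesis unfolding is_float_def
    by (intro exI[of _ M] exI[of _ "k + e"]) (auto simp: powr_add)
qed

lemma is_float_powr: "p \<ge> 1 \<Longrightarrow> is_float p (2 powr of_int e)"
  using is_float_intro[of p 1 e] by simp

text \<open>Since |M| < 2^p, a float of magnitude at least 2^e must have its exponent at least e - p
  + 1, so it lies on the grid of that binade.\<close>

lemma is_float_multiple:
  assumes "is_float p f" and "2 powr of_int e \<le> \<bar>f\<bar>"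
  shows "\<exists>N::int. f = of_int N * 2 powr of_int (e - int p + 1)"
proof -
  obtain M k :: int where f: "f = of_int M * 2 powr of_int k" and M: "\<bar>M\<bar> \<le> 2 ^ p - 1"
    using assms(1) unfolding is_float_def by auto
  have "2 powr of_int e \<le> real_of_int \<bar>M\<bar> * 2 powr of_int k"
    using assms(2) f by (simp add: abs_mult)
  also have "\<dots> < real_of_int (2 ^ p) * 2 powr of_int k"
    using M by (intro mult_strict_right_mono) (simp_all del: of_int_power)
  also have "\<dots> = 2 powr of_int (int p + k)"
    by (simp add: powr_add powr_realpow)
  finally have "e < int p + k" by simp
  then obtain j where "k = int j + (e - int p + 1)"
    using zle_iff_zadd[of "e - int p + 1" k] by auto
  then have "f = of_int (M * 2 ^ j) * 2 powr of_int (e - int p + 1)"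
    unfolding f by (simp add: powr_add powr_diff powr_realpow)
  then show ?thesis by blast
qed

lemma floor_log2_bounds:
  fixes a :: real
  assumes "a > 0"
  shows "2 powr of_int \<lfloor>log 2 a\<rfloor> \<le> a" and "a < 2 * 2 powr of_int \<lfloor>log 2 a\<rfloor>"
proof -
  show "2 powr of_int \<lfloor>log 2 a\<rfloor> \<le> a"
    using assms by (simp add: powr_le_iff)
  have "a < 2 powr (of_int \<lfloor>log 2 a\<rfloor> + 1)"
    using assms by (subst less_powr_iff) auto
  then show "a < 2 * 2 powr of_int \<lfloor>log 2 a\<rfloor>" by (simp add: powr_add)
qed

lemma round_even_error: "\<bar>of_int (round_even m) - m\<bar> \<le> 1 / 2"
  unfolding round_even_def Let_def by (auto simp: abs_if) linarith+

lemma round_even_nearest: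
  fixes n :: int
  shows "\<bar>of_int (round_even m) - m\<bar> \<le> \<bar>of_int n - m\<bar>"
proof (cases "n = round_even m")
  case False
  then have "\<bar>n - round_even m\<bar> \<ge> 1" by linarith
  then have "\<bar>real_of_int n - of_int (round_even m)\<bar> \<ge> 1" by linarith
  then show ?thesis using round_even_error[of m] by linarith
qed simp

lemma abs_diff_scale:
  fixes a x w :: real
  assumes "w > 0"
  shows "\<bar>a - x / w\<bar> * w = \<bar>a * w - x\<bar>"
proof -
  have "a * w - x = (a - x / w) * w" using assms by (simp add: field_simps)
  then show ?thesis using assms by (simp only: abs_mult abs_of_pos)
qed

lemma RN_grid:
  fixes x :: real and n :: int
  assumes "x \<noteq> 0" and "e = \<lfloor>log 2 \<bar>x\<bar>\<rfloor>"
  shows "\<bar>RN p x - x\<bar> \<le> \<bar>of_int n * 2 powr of_int (e - int p + 1) - x\<bar>"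
proof -
  define ulp where "ulp = 2 powr real_of_int (e - int p + 1)"
  have ulp: "ulp > 0" by (simp add: ulp_def)
  have "RN p x = of_int (round_even (x / ulp)) * ulp"
    using assms by (simp add: RN_def Let_def ulp_def)
  then have "\<bar>RN p x - x\<bar> = \<bar>of_int (round_even (x / ulp)) - x / ulp\<bar> * ulp"
    using abs_diff_scale[OF ulp] by simp
  also have "\<dots> \<le> \<bar>of_int n - x / ulp\<bar> * ulp"
    using round_even_nearest ulp by (intro mult_right_mono) auto
  also have "\<dots> = \<bar>of_int n * ulp - x\<bar>"
    using abs_diff_scale[OF ulp] .
  finally show ?thesis by (simp add: ulp_def)
qed

text \<open>By definition \<open>RN\<close> picks the nearest point of the grid belonging to the
  binade of x. A float of magnitude at least 2^e lies on that grid; a smaller one is no closer to x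
  than the grid point \<open>sgn x * 2 powr e\<close>.\<close>

lemma RN_nearest:
  assumes "p \<ge> 1" and "is_float p f"
  shows "\<bar>RN p x - x\<bar> \<le> \<bar>f - x\<bar>"
proof (cases "x = 0")
  case False
  define e where "e = \<lfloor>log 2 \<bar>x\<bar>\<rfloor>"
  have e: "2 powr of_int e \<le> \<bar>x\<bar>"
    using floor_log2_bounds[of "\<bar>x\<bar>"] False by (simp add: e_def)
  show ?thesis
  proof (cases "2 powr of_int e \<le> \<bar>f\<bar>")
    case True
    from is_float_multiple[OF assms(2) this] RN_grid[OF False e_def] show ?thesis by metis
  next
    case f: False
    obtain q where q: "p = Suc q" using assms(1) by (cases p) auto
    have "of_int (if x > 0 then 2 ^ q else - (2 ^ q)) * 2 powr real_of_int (e - int p + 1)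
        = sgn x * 2 powr of_int e"
      using False by (simp add: q powr_diff powr_realpow sgn_if)
    with RN_grid[OF False e_def] have "\<bar>RN p x - x\<bar> \<le> \<bar>sgn x * 2 powr of_int e - x\<bar>"
      by metis
    also have "\<dots> \<le> \<bar>f - x\<bar>" using e f False by (auto simp: sgn_if abs_if split: if_splits)
    finally show ?thesis .
  qed
qed (simp add: RN_def)

lemma RN_float: "p \<ge> 1 \<Longrightarrow> is_float p x \<Longrightarrow> RN p x = x"
  using RN_nearest[of p x x] by simp

lemma RN_le_float:
  assumes "p \<ge> 1" and "is_float p f" and "x \<le> f"
  shows "RN p x \<le> f"
  using RN_nearest[OF assms(1,2), of x] assms(3) by linarith

lemma RN_ge_float:
  assumes "p \<ge> 1" and "is_float p f" and "f \<le> x"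
  shows "f \<le> RN p x"
  using RN_nearest[OF assms(1,2), of x] assms(3) by linarith

lemma RN_nonneg: "p \<ge> 1 \<Longrightarrow> 0 \<le> x \<Longrightarrow> 0 \<le> RN p x"
  using RN_ge_float[of p 0] is_float_of_int[of p 0] by simp

lemma RN_is_float:
  assumes "p \<ge> 1"
  shows "is_float p (RN p x)"
proof (cases "x = 0")
  case True
  then show ?thesis using is_float_of_int[of p 0] assms by (simp add: RN_def)
next
  case False
  define e where "e = \<lfloor>log 2 \<bar>x\<bar>\<rfloor>"
  define N where "N = round_even (x / 2 powr of_int (e - int p + 1))"
  have RN: "RN p x = of_int N * 2 powr of_int (e - int p + 1)"
    using False by (simp add: RN_def Let_def e_def N_def)
  have "\<bar>x\<bar> \<le> 2 powr of_int (e + 1)"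
    using floor_log2_bounds[of "\<bar>x\<bar>"] False by (simp add: e_def powr_add)
  then have "\<bar>RN p x\<bar> \<le> 2 powr of_int (e + 1)"
    using RN_le_float[OF assms is_float_powr[OF assms, of "e + 1"], of x]
      RN_ge_float[OF assms is_float_intro[OF assms, of "-1" "e + 1"], of x] by (auto simp: abs_le_iff)
  also have "2 powr of_int (e + 1) = real_of_int (2 ^ p) * 2 powr of_int (e - int p + 1)"
    by (simp add: powr_add powr_diff powr_realpow)
  finally have "\<bar>of_int N\<bar> \<le> real_of_int (2 ^ p)" by (simp add: RN abs_mult)
  then have "\<bar>N\<bar> \<le> 2 ^ p" by (simp del: of_int_power flip: of_int_abs)
  then show ?thesis unfolding RN by (rule is_float_intro[OF assms])
qed

text \<open>Here 2^e may exceed |x|: multiples of the spacing w up to 2^p w are floats, so rounding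
  to this possibly coarser grid already achieves the error. Errors can thus be read off from upper
  bounds on |x|.\<close>

lemma RN_abs_error:
  assumes "p \<ge> 1" and "\<bar>x\<bar> \<le> 2 * 2 powr of_int e"
  shows "\<bar>RN p x - x\<bar> \<le> 2 powr - real p * 2 powr of_int e"
proof -
  define w where "w = 2 powr real_of_int (e - int p + 1)"
  have w: "w > 0" "w = 2 * (2 powr - real p * 2 powr of_int e)"
    by (simp_all add: w_def powr_add powr_diff powr_minus field_simps)
  have top: "2 * 2 powr of_int e = real_of_int (2 ^ p) * w"
    by (simp add: w_def powr_add powr_diff powr_realpow)
  define n where "n = round (x / w)"
  have n: "\<bar>of_int n - x / w\<bar> \<le> 1 / 2" unfolding n_def by (rule of_int_round_abs_le)
  have "\<bar>x / w\<bar> \<le> real_of_int (2 ^ p)" using assms(2) w(1) unfolding top by (simp add: field_simps)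
  then have "\<bar>real_of_int n\<bar> < real_of_int (2 ^ p) + 1" using n by linarith
  then have "\<bar>n\<bar> \<le> 2 ^ p" by linarith
  from is_float_intro[OF assms(1) this, of "e - int p + 1"] have "is_float p (of_int n * w)"
    by (simp add: w_def)
  from RN_nearest[OF assms(1) this, of x] have "\<bar>RN p x - x\<bar> \<le> \<bar>of_int n - x / w\<bar> * w"
    using abs_diff_scale[OF w(1)] by simp
  also have "\<dots> \<le> 1 / 2 * w" using n w(1) by (intro mult_right_mono) auto
  finally show ?thesis using w(2) by simp
qed

text \<open>The worst case is |x| = b (1 + u), halfway between the power of two b and its successor.
  Above it the half-spacing u b is divided by a larger |x|; below it the distance to b itself is
  small enough.\<close>

lemma RN_rel_error:
  assumes "p \<ge> 1"
  defines "u \<equiv> 2 powr - real p"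
  shows "\<bar>RN p x - x\<bar> \<le> u / (1 + u) * \<bar>x\<bar>"
proof (cases "x = 0")
  case False
  define b where "b = 2 powr real_of_int \<lfloor>log 2 \<bar>x\<bar>\<rfloor>"
  have b: "b > 0" "b \<le> \<bar>x\<bar>" "\<bar>x\<bar> < 2 * b"
    using floor_log2_bounds[of "\<bar>x\<bar>"] False by (auto simp: b_def)
  have u: "u > 0" by (simp add: u_def)
  show ?thesis
  proof (cases "b * (1 + u) \<le> \<bar>x\<bar>")
    case True
    have "\<bar>RN p x - x\<bar> \<le> u * b" unfolding u_def b_def
      using b by (intro RN_abs_error assms) (simp add: b_def)
    also have "\<dots> = u / (1 + u) * (b * (1 + u))" using u by (simp add: field_simps)
    also have "\<dots> \<le> u / (1 + u) * \<bar>x\<bar>" using u True by (intro mult_left_mono) auto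
    finally show ?thesis .
  next
    case F: False
    have "is_float p (sgn x * b)"
      using is_float_intro[OF assms(1), of 1 "\<lfloor>log 2 \<bar>x\<bar>\<rfloor>"] is_float_intro[OF assms(1), of "-1" "\<lfloor>log 2 \<bar>x\<bar>\<rfloor>"] False
      by (auto simp: sgn_if b_def)
    from RN_nearest[OF assms(1) this, of x] have "\<bar>RN p x - x\<bar> \<le> \<bar>x\<bar> - b"
      using b False by (auto simp: sgn_if abs_if split: if_splits)
    also have "\<dots> \<le> u / (1 + u) * \<bar>x\<bar>" using F u by (simp add: field_simps)
    finally show ?thesis .
  qed
qed (simp add: RN_def)

lemma is_float_pos_cases:
  assumes "is_float p x" and "x > 0"
  obtains M k :: int where "x = of_int M * 2 powr of_int k" "1 \<le> M" "M \<le> 2 ^ p - 1"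
proof -
  obtain M k :: int where x: "x = of_int M * 2 powr of_int k" "\<bar>M\<bar> \<le> 2 ^ p - 1"
    using assms(1) unfolding is_float_def by auto
  then have "M > 0" using assms(2) by (simp add: zero_less_mult_iff)
  then show ?thesis using that[of M k] x by auto
qed

section \<open>Quotients of two floats\<close>

lemma int_ratio_gap:
  fixes A B :: int
  assumes "1 \<le> B" and "A \<le> N \<or> B \<le> N" and "of_int A / of_int B > (1::real)"
  shows "1 + 1 / of_int N \<le> (of_int A / of_int B :: real)"
proof -
  have AB: "A \<ge> B + 1" using assms(1,3) by (simp add: field_simps)
  then have BN: "B \<le> N" using assms(2) by auto
  have "1 + 1 / real_of_int N \<le> 1 + 1 / of_int B"
    using assms(1) BN by (simp add: frac_le)
  also have "\<dots> = (of_int (B + 1)) / of_int B" using assms(1) by (simp add: field_simps)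
  also have "\<dots> \<le> of_int A / of_int B" using AB assms(1) by (intro divide_right_mono) (simp_all del: of_int_add)
  finally show ?thesis .
qed

text \<open>After division by 2^e, the remaining power of two can be moved into either the numerator
  or the denominator. The other one stays a significand of at most 2^p - 1, and a fraction A / B > 1
  of integers exceeds 1 by at least 1 / B.\<close>

lemma float_ratio_gap:
  fixes e :: int
  assumes "is_float p y" "y > 0" and "is_float p z" "z > 0"
    and "y / z > 2 powr of_int e"
  shows "(1 + 1 / (2 ^ p - 1)) * 2 powr of_int e \<le> y / z"
proof -
  obtain M k :: int where y: "y = of_int M * 2 powr of_int k" "1 \<le> M" "M \<le> 2 ^ p - 1"
    using is_float_pos_cases assms(1,2) by blast
  obtain N l :: int where z: "z = of_int N * 2 powr of_int l" "1 \<le> N" "N \<le> 2 ^ p - 1"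
    using is_float_pos_cases assms(3,4) by blast
  define j where "j = k - l - e"
  have q: "y / z = (of_int M / of_int N * 2 powr of_int j) * 2 powr of_int e"
    unfolding y z j_def by (simp add: powr_diff)
  have "\<exists>A B :: int. of_int M / of_int N * 2 powr of_int j = (of_int A / of_int B :: real)
      \<and> 1 \<le> B \<and> (A \<le> 2 ^ p - 1 \<or> B \<le> 2 ^ p - 1)"
  proof (cases "j \<ge> 0")
    case True
    then obtain n where "j = int n" using zero_le_imp_eq_int by blast
    then show ?thesis using z by (intro exI[of _ "M * 2 ^ n"] exI[of _ N]) (simp add: powr_realpow)
  next
    case False
    then have "0 \<le> - j" by simp
    then obtain n where "- j = int n" using zero_le_imp_eq_int by blast
    then have j: "j = - int n" by simp
    have "1 * 1 \<le> N * 2 ^ n" using z(2) by (intro mult_mono) auto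
    then show ?thesis using y unfolding j
      by (intro exI[of _ M] exI[of _ "N * 2 ^ n"]) (simp add: powr_realpow powr_minus field_simps)
  qed
  then obtain A B :: int where AB: "of_int M / of_int N * 2 powr of_int j = (of_int A / of_int B :: real)"
    "1 \<le> B" "A \<le> 2 ^ p - 1 \<or> B \<le> 2 ^ p - 1" by blast
  have "1 * 2 powr of_int e < real_of_int A / of_int B * 2 powr of_int e"
    using assms(5) unfolding q AB(1) by (simp only: mult_1)
  then have "real_of_int A / of_int B > 1"
    by (rule mult_right_less_imp_less) simp
  from int_ratio_gap[OF AB(2,3) this] show ?thesis
    unfolding q AB(1) by (intro mult_right_mono) auto
qed

text \<open>Relative error \<open>u / (1 + u)\<close> would need a quotient just above a power of two, which two
  floats cannot produce.\<close>
lemma RN_divide_error: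
  assumes "p \<ge> 3" and "is_float p y" "y \<ge> 0" and "is_float p z" "z > 0"
  defines "u \<equiv> 2 powr - real p"
  shows "\<bar>RN p (y / z) - y / z\<bar> \<le> (u - 2 * u ^ 2) * (y / z)"
proof (cases "y = 0")
  case False
  then have "y > 0" using assms by simp
  have p: "p \<ge> 1" using assms by simp
  define a where "a = y / z"
  have a: "a > 0" using \<open>y > 0\<close> assms by (simp add: a_def)
  define e where "e = \<lfloor>log 2 a\<rfloor>"
  define E where "E = 2 powr real_of_int e"
  have E: "E > 0" "E \<le> a" "a < 2 * E"
    using floor_log2_bounds[OF a] by (auto simp: e_def E_def)
  have u0: "u > 0" by (simp add: u_def)
  have "u \<le> 2 powr - 3" unfolding u_def using assms(1) by (intro powr_mono) auto
  then have u: "u \<le> 1 / 8" by (simp add: powr_minus powr_numeral)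
  have up: "(2::real) ^ p = 1 / u" by (simp add: u_def powr_minus powr_realpow inverse_eq_divide)
  obtain q where q: "p = Suc q" using p by (cases p) auto
  have "(2::int) ^ 0 \<le> 2 ^ q" by (rule power_increasing) auto
  then have "is_float p (of_int (2 ^ q + 1) * 2 powr of_int (e - int q))"
    by (intro is_float_intro[OF p]) (simp add: q)
  also have "of_int (2 ^ q + 1) * 2 powr of_int (e - int q) = E * (1 + 2 * u)"
    by (simp add: E_def u_def q powr_diff powr_minus powr_add powr_realpow field_simps)
  finally have next_float: "is_float p (E * (1 + 2 * u))" .
  note err1 = RN_nearest[OF p next_float, of a]
  have sq: "u ^ 2 \<le> u / 8" using u u0 by (simp add: power2_eq_square)
  \<comment> \<open>E (1 + 2 u) is the successor of E, and E (1 + 3 u) is the midpoint between it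
    and the next float. Beyond the midpoint the plain bound u E suffices.\<close>
  consider "a = E" | "a > E" "a < E * (1 + 2 * u)" | "E * (1 + 2 * u) \<le> a" "a \<le> E * (1 + 3 * u)"
    | "E * (1 + 3 * u) < a" using E by linarith
  then have "\<bar>RN p a - a\<bar> \<le> (u - 2 * u ^ 2) * a"
  proof cases
    case 1
    have "RN p E = E" unfolding E_def by (rule RN_float[OF p is_float_powr[OF p]])
    then show ?thesis using 1 E sq u0 by simp
  next
    case 2
    \<comment> \<open>The gap lemma gives a >= E / (1 - u), so the successor of E is above a by at
      most a ((1 - u) (1 + 2 u) - 1) = (u - 2 u^2) a. This is the origin of the constant.\<close>
    have "(1 + 1 / (2 ^ p - 1)) * E \<le> a"
      using float_ratio_gap[of p y z e] 2 assms \<open>y > 0\<close> by (simp add: a_def E_def)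
    also have "1 + 1 / (2 ^ p - 1) = 1 / (1 - u)"
      unfolding up using u u0 by (simp add: field_simps)
    finally have "E \<le> a * (1 - u)" using u by (simp add: field_simps)
    then have "E * (1 + 2 * u) \<le> a * (1 - u) * (1 + 2 * u)" using u0 by (intro mult_right_mono) auto
    then show ?thesis using err1 2 by (simp add: algebra_simps power2_eq_square)
  next
    case 3
    have "(1 - u + 2 * u ^ 2) * a \<le> (1 - u + 2 * u ^ 2) * (E * (1 + 3 * u))"
      using 3 u u0 by (intro mult_left_mono) auto
    also have "\<dots> = E * (1 + 2 * u - u ^ 2 * (1 - 6 * u))" by (simp add: algebra_simps power2_eq_square)
    also have "\<dots> \<le> E * (1 + 2 * u)" using E u by (intro mult_left_mono) auto
    finally show ?thesis using err1 3 by (simp add: algebra_simps)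
  next
    case 4
    have "\<bar>RN p a - a\<bar> \<le> u * E" unfolding u_def E_def
      using E a by (intro RN_abs_error p) (simp add: E_def)
    also have "\<dots> \<le> u * E * (1 + u * (1 - 6 * u))" using u u0 E by simp
    also have "\<dots> = (u - 2 * u ^ 2) * (E * (1 + 3 * u))" by (simp add: algebra_simps power2_eq_square)
    also have "\<dots> \<le> (u - 2 * u ^ 2) * a" using 4 sq u0 by (intro mult_left_mono) auto
    finally show ?thesis .
  qed
  then show ?thesis by (simp add: a_def)
qed (simp add: RN_def)

text \<open>A variant of Sterbenz' lemma: both operands lie on the grid of \<open>y\<close>.\<close>
lemma RN_diff_cases:
  assumes "p \<ge> 1" and "is_float p x" "is_float p y" and "0 < y" "y \<le> x"
  shows "RN p (x - y) \<le> y \<Longrightarrow> is_float p (x - y)"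
    and "RN p (x - y) > y \<Longrightarrow> x - y > y"
proof -
  define e where "e = \<lfloor>log 2 y\<rfloor>"
  have e: "2 powr of_int e \<le> y" "y < 2 * 2 powr of_int e"
    using floor_log2_bounds[OF assms(4)] by (auto simp: e_def)
  obtain M :: int where M: "y = of_int M * 2 powr of_int (e - int p + 1)"
    using is_float_multiple[OF assms(3)] e(1) assms(4) by fastforce
  obtain N :: int where N: "x = of_int N * 2 powr of_int (e - int p + 1)"
    using is_float_multiple[OF assms(2), of e] e(1) assms(4,5) by fastforce
  have d: "x - y = of_int (N - M) * 2 powr of_int (e - int p + 1)"
    by (simp add: M N algebra_simps)
  have NM: "N - M \<ge> 0" using assms(5) unfolding M N by simp
  have top: "of_int (2 ^ p) * 2 powr real_of_int (e - int p + 1) = 2 * 2 powr of_int e"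
    by (simp add: powr_add powr_diff powr_realpow)
  \<comment> \<open>On the grid of y the difference either fits into p bits and is exact, or it is
    at least the float 2^(e+1) > y, and rounding cannot bring it below that.\<close>
  have exact: "is_float p (x - y)" if "N - M \<le> 2 ^ p"
    unfolding d using that NM by (intro is_float_intro assms(1)) auto
  have large: "2 * 2 powr of_int e \<le> x - y" if "\<not> N - M \<le> 2 ^ p"
  proof -
    have "real_of_int (2 ^ p) \<le> of_int (N - M)" using that by (simp only: of_int_le_iff)
    then show ?thesis unfolding d top[symmetric] by (intro mult_right_mono) auto
  qed
  have fl: "is_float p (2 * 2 powr of_int e)"
    using is_float_powr[OF assms(1), of "e + 1"] by (simp add: powr_add mult.commute)
  show "is_float p (x - y)" if "RN p (x - y) \<le> y"
    using exact large RN_ge_float[OF assms(1) fl, of "x - y"] that e by fastforce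
  show "x - y > y" if "RN p (x - y) > y"
    using exact large RN_float[OF assms(1), of "x - y"] that e by fastforce
qed

section \<open>The error function\<close>

text \<open>(1 + u)^2 times the inner denominator of \<open>phi\<close>, which turns
  \<open>phi\<close> into a quotient of polynomials with coefficients in Q(sqrt 2).\<close>

definition phi_denom :: "real \<Rightarrow> real" where
  "phi_denom u = (1 + sqrt 2) * (1 + u) ^ 2 - u * (2 + u) * (1 + 2 * u) ^ 2"

lemma phi_closed_form:
  assumes "1 + u \<noteq> 0" and "phi_denom u \<noteq> 0"
  shows "phi u = (phi_denom u + (1 - u) * (1 + 2 * u) * (1 + u) ^ 2) * (1 + 2 * u)
                 / (sqrt 2 * (1 + u) * phi_denom u) - 1"
proof -
  have e: "1 + sqrt 2 - u * (2 + u) * (1 + 2 * u) ^ 2 / (1 + u) ^ 2 = phi_denom u / (1 + u) ^ 2"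
    using assms(1) by (simp add: phi_denom_def field_simps)
  have s: "1 + 1 / (1 + sqrt 2) = sqrt 2"
    using real_sqrt_mult_self[of 2] by (simp add: field_simps add_pos_pos add_nonneg_eq_0_iff)
  have "1 + u * (1 - 2 * u) = (1 - u) * (1 + 2 * u)"
    by (simp add: algebra_simps)
  then show ?thesis
    unfolding phi_def e s using assms by (simp add: field_simps)
qed

lemma quotient_minus_one_eqI:
  fixes a d c k q :: real
  assumes "a - (1 + c) * d = k * q" and "d \<noteq> 0"
  shows "a / d - 1 - c = k * (q / d)"
  using assms by (simp add: field_simps)

text \<open>An exact identity in place of Taylor's theorem: numerator minus polynomial times
  denominator is divisible by u^4. For the O(u^4) claim it is then enough that the explicit cofactor
  is continuous at 0.\<close>

lemma phi_cubic_remainder: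
  assumes "1 + u \<noteq> 0" and "phi_denom u \<noteq> 0"
  shows "phi u - ((5 * sqrt 2 / 2 - 2) * u + (30 - 39 * sqrt 2 / 2) * u ^ 3) =
    u ^ 4 * ((58 * sqrt 2 - 73 + (329 * sqrt 2 - 424) * u + (631 * sqrt 2 - 820) * u ^ 2
      + (480 * sqrt 2 - 624) * u ^ 3 + (120 * sqrt 2 - 156) * u ^ 4) / (sqrt 2 * (1 + u) * phi_denom u))"
proof -
  define s where "s = sqrt 2"
  have s2: "s * s = 2" "s * (s * a) = 2 * a" for a
    by (simp_all add: s_def flip: mult.assoc)
  have D: "s * (1 + u) * phi_denom u \<noteq> 0" using assms by (simp add: s_def)
  have "(phi_denom u + (1 - u) * (1 + 2 * u) * (1 + u) ^ 2) * (1 + 2 * u)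
      - (1 + ((5 * s / 2 - 2) * u + (30 - 39 * s / 2) * u ^ 3)) * (s * (1 + u) * phi_denom u)
    = u ^ 4 * (58 * s - 73 + (329 * s - 424) * u + (631 * s - 820) * u ^ 2
      + (480 * s - 624) * u ^ 3 + (120 * s - 156) * u ^ 4)"
    unfolding phi_denom_def s_def[symmetric]
    by (simp add: eval_nat_numeral algebra_simps s2)
  from quotient_minus_one_eqI[OF this D] show ?thesis
    unfolding phi_closed_form[OF assms] s_def[symmetric] .
qed

lemma phi_quadratic_remainder:
  assumes "1 + u \<noteq> 0" and "phi_denom u \<noteq> 0"
  shows "phi u - ((5 * sqrt 2 / 2 - 2) * u + u ^ 2 / 12) =
    u ^ 2 * ((- 1 / 6 - sqrt 2 / 12 + (41 / 2 - 109 * sqrt 2 / 12) * u + (135 / 2 - 85 * sqrt 2 / 3) * u ^ 2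
      + (407 / 6 - 79 * sqrt 2 / 3) * u ^ 3 + (20 - 20 * sqrt 2 / 3) * u ^ 4 + sqrt 2 / 3 * u ^ 5)
      / (sqrt 2 * (1 + u) * phi_denom u))"
proof -
  define s where "s = sqrt 2"
  have s2: "s * s = 2" "s * (s * a) = 2 * a" for a
    by (simp_all add: s_def flip: mult.assoc)
  have D: "s * (1 + u) * phi_denom u \<noteq> 0" using assms by (simp add: s_def)
  define Q where "Q = - 1 / 6 - s / 12 + (41 / 2 - 109 * s / 12) * u + (135 / 2 - 85 * s / 3) * u ^ 2
      + (407 / 6 - 79 * s / 3) * u ^ 3 + (20 - 20 * s / 3) * u ^ 4 + s / 3 * u ^ 5"
  have "12 * ((phi_denom u + (1 - u) * (1 + 2 * u) * (1 + u) ^ 2) * (1 + 2 * u)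
      - (1 + ((5 * s / 2 - 2) * u + u ^ 2 / 12)) * (s * (1 + u) * phi_denom u)) = 12 * (u ^ 2 * Q)"
    unfolding phi_denom_def s_def[symmetric] Q_def
    by (simp add: eval_nat_numeral algebra_simps s2)
  then have "(phi_denom u + (1 - u) * (1 + 2 * u) * (1 + u) ^ 2) * (1 + 2 * u)
      - (1 + ((5 * s / 2 - 2) * u + u ^ 2 / 12)) * (s * (1 + u) * phi_denom u) = u ^ 2 * Q"
    by simp
  from quotient_minus_one_eqI[OF this D] show ?thesis
    unfolding phi_closed_form[OF assms] s_def[symmetric] Q_def .
qed

lemma sqrt2_bounds: "1414213 / 1000000 \<le> sqrt 2" "sqrt 2 \<le> 1414214 / 1000000"
  by (rule real_le_rsqrt, simp add: power2_eq_square) (rule real_le_lsqrt, simp_all add: power2_eq_square)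

lemma small_power_bounds:
  fixes u :: real
  assumes "0 \<le> u" "u \<le> 1/32"
  shows "0 \<le> u ^ n" "u ^ 2 \<le> u / 32" "u ^ 3 \<le> u ^ 2 / 32" "u ^ 4 \<le> u ^ 3 / 32" "u ^ 5 \<le> u ^ 4 / 32"
proof -
  have "u ^ Suc n \<le> 1 / 32 * u ^ n" for n
    using assms by (simp only: power_Suc) (intro mult_right_mono zero_le_power)
  from this[of 1] this[of 2] this[of 3] this[of 4]
  show "u ^ 2 \<le> u / 32" "u ^ 3 \<le> u ^ 2 / 32" "u ^ 4 \<le> u ^ 3 / 32" "u ^ 5 \<le> u ^ 4 / 32"
    by (auto simp: eval_nat_numeral)
qed (use assms in simp)

lemma phi_denom_ge:
  assumes "0 \<le> u" "u \<le> 1/32"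
  shows "2 \<le> phi_denom u"
proof -
  have p: "0 \<le> u^2" "u^2 \<le> u/32" "u^3 \<le> u^2/32" "u^4 \<le> u^3/32" 
    using small_power_bounds[OF assms] by auto
  have "2 * sqrt 2 * u \<ge> 28 / 10 * u" "sqrt 2 * u^2 \<ge> 0"
    by (intro mult_right_mono mult_nonneg_nonneg; use sqrt2_bounds assms in simp)+
  moreover have "phi_denom u = 1 + sqrt 2 + 2 * sqrt 2 * u + sqrt 2 * u^2 - 8 * u^2 - 12 * u^3 - 4 * u^4"
    by (simp add: phi_denom_def eval_nat_numeral algebra_simps)
  ultimately show ?thesis using p sqrt2_bounds assms by linarith
qed

text \<open>The expansion of \<open>phi\<close> has no u^2 term and its cubic coefficient is about
  2.42, so u^2 / 12 has to absorb about 2.42 u^3 up to u = 1/32. In the cofactor, the constant term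
  -0.2845 outweighs the remaining terms, which reach at most about 0.267.\<close>

lemma phi_quadratic_bound:
  assumes "0 \<le> u" "u \<le> 1/32"
  shows "phi u \<le> (5 * sqrt 2 / 2 - 2) * u + u ^ 2 / 12"
proof -
  have N: "phi_denom u > 0" using phi_denom_ge[OF assms] by linarith
  have p: "0 \<le> u^2" "u^2 \<le> u/32" "u^3 \<le> u^2/32" "u^4 \<le> u^3/32" "u^5 \<le> u^4/32" 
    using small_power_bounds[OF assms] by auto
  have q: "(41 / 2 - 109 * sqrt 2 / 12) * u \<le> 766 / 100 * u" "(135 / 2 - 85 * sqrt 2 / 3) * u^2 \<le> 275 / 10 * u^2"
    "(407 / 6 - 79 * sqrt 2 / 3) * u^3 \<le> 31 * u^3" "(20 - 20 * sqrt 2 / 3) * u^4 \<le> 11 * u^4"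
    "sqrt 2 / 3 * u^5 \<le> 1 * u^5"
    by (intro mult_right_mono; use sqrt2_bounds assms in simp)+
  have "u ^ 2 * ((- 1 / 6 - sqrt 2 / 12 + (41 / 2 - 109 * sqrt 2 / 12) * u + (135 / 2 - 85 * sqrt 2 / 3) * u ^ 2
      + (407 / 6 - 79 * sqrt 2 / 3) * u ^ 3 + (20 - 20 * sqrt 2 / 3) * u ^ 4 + sqrt 2 / 3 * u ^ 5)
      / (sqrt 2 * (1 + u) * phi_denom u)) \<le> 0"
    using p q sqrt2_bounds assms N
    by (intro mult_nonneg_nonpos divide_nonpos_nonneg) auto
  then show ?thesis using phi_quadratic_remainder[of u] N assms by auto
qed

lemma phi_cubic_expansion:
  "(\<lambda>u. phi u - ((5 * sqrt 2 / 2 - 2) * u + (30 - 39 * sqrt 2 / 2) * u ^ 3)) \<in> O[at 0](\<lambda>u. u ^ 4)"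
proof -
  define Q where "Q u = (58 * sqrt 2 - 73 + (329 * sqrt 2 - 424) * u + (631 * sqrt 2 - 820) * u ^ 2
      + (480 * sqrt 2 - 624) * u ^ 3 + (120 * sqrt 2 - 156) * u ^ 4) / (sqrt 2 * (1 + u) * phi_denom u)" for u
  have cont: "isCont phi_denom u" for u
    unfolding phi_denom_def by (intro continuous_intros)
  have D0: "phi_denom 0 > 0" by (simp add: phi_denom_def add_pos_pos)
  have "isCont Q 0"
    unfolding Q_def using D0 by (intro continuous_intros cont) auto
  then have "Q \<in> O[at 0](\<lambda>_. 1)"
    by (intro bigoI_tendsto[where c = "Q 0"]) (auto simp: isCont_def)
  then have big: "(\<lambda>u. u ^ 4 * Q u) \<in> O[at 0](\<lambda>u. u ^ 4 * 1)"
    by (rule landau_o.big.mult_left)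
  have "eventually (\<lambda>u. phi_denom u > 0) (at 0)"
    using cont[of 0] D0 by (auto simp: isCont_def order_tendsto_iff)
  moreover have "eventually (\<lambda>u::real. u > -1) (at 0)"
    by (rule order_tendstoD(1)[OF tendsto_ident_at]) simp
  ultimately have "eventually (\<lambda>u. phi u - ((5 * sqrt 2 / 2 - 2) * u + (30 - 39 * sqrt 2 / 2) * u ^ 3)
      = u ^ 4 * Q u) (at 0)"
    by eventually_elim (unfold Q_def, rule phi_cubic_remainder, auto)
  from landau_o.big.in_cong[OF this] big show ?thesis by simp
qed

section \<open>The last two operations\<close>

text \<open>Equal to (2 u + u^2) (1 + v)^2 with v = u / (1 + u). At x = y the last sum, between 2
  and 4, loses up to 2 u; \<open>Pl\<close> is off by u^2; the factor (1 + v)^2 pays for rounding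
  \<open>Pl\<close>, of size at most 2 u, two more times on its way to \<open>r6\<close>.\<close>

definition z_error :: "real \<Rightarrow> real" where
  "z_error u = u * (2 + u) * (1 + 2 * u) ^ 2 / (1 + u) ^ 2"

text \<open>This is (1 + k) (1 + sqrt 2) / (1 + sqrt 2 - E) - 1 with k = u - 2 u^2 and E =
  \<open>z_error u\<close>: the relative error of the rounded y / z at x = y when z is too small by
  E and the quotient is rounded up as far as possible. It is the X of the overview.\<close>

definition quot_error :: "real \<Rightarrow> real" where
  "quot_error u = ((u - 2 * u ^ 2) * (1 + sqrt 2) + z_error u) / (1 + sqrt 2 - z_error u)"

text \<open>Exactly, E = 2 u + 5 u^2 - u^4 / (1 + u)^2.\<close>

lemma z_error_bounds:
  assumes "0 < u" "u \<le> 1/32"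
  shows "2 * u + 499 / 100 * u ^ 2 \<le> z_error u" "z_error u \<le> 2 * u + 5 * u ^ 2" "z_error u \<le> 216 / 100 * u"
proof -
  have p: "0 \<le> u ^ 2" "u ^ 2 \<le> u / 32" "u ^ 3 \<le> u ^ 2 / 32" "u ^ 4 \<le> u ^ 3 / 32" "0 \<le> u ^ 4"
    using small_power_bounds[of u] assms by auto
  have e: "u * (2 + u) * (1 + 2 * u) ^ 2 = 2 * u + 9 * u ^ 2 + 12 * u ^ 3 + 4 * u ^ 4"
    "(2 * u + 499 / 100 * u ^ 2) * (1 + u) ^ 2
      = 2 * u + 899 / 100 * u ^ 2 + 1198 / 100 * u ^ 3 + 499 / 100 * u ^ 4"
    "(2 * u + 5 * u ^ 2) * (1 + u) ^ 2 = 2 * u + 9 * u ^ 2 + 12 * u ^ 3 + 5 * u ^ 4"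
    by (simp_all add: eval_nat_numeral field_simps)
  have "(2 * u + 499 / 100 * u ^ 2) * (1 + u) ^ 2 \<le> u * (2 + u) * (1 + 2 * u) ^ 2"
    unfolding e using p assms(1) by linarith
  then show "2 * u + 499 / 100 * u ^ 2 \<le> z_error u"
    using assms unfolding z_error_def by (subst pos_le_divide_eq) auto
  have "u * (2 + u) * (1 + 2 * u) ^ 2 \<le> (2 * u + 5 * u ^ 2) * (1 + u) ^ 2"
    unfolding e using p assms(1) by linarith
  then show "z_error u \<le> 2 * u + 5 * u ^ 2"
    using assms unfolding z_error_def by (subst pos_divide_le_eq) auto
  then show "z_error u \<le> 216 / 100 * u" using p by linarith
qed

lemma quot_error_eq:
  assumes "0 < u" "u \<le> 1/32"
  shows "quot_error u * (1 + sqrt 2 - z_error u) = (u - 2 * u ^ 2) * (1 + sqrt 2) + z_error u"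
  using z_error_bounds[OF assms] assms sqrt2_bounds by (simp add: quot_error_def)

text \<open>With S = 1 + sqrt 2, the linear equation X (S - E) = k S + E yields X = (2 sqrt 2 - 1) u
  + (3 - sqrt 2) u^2 + ..., and 3 - sqrt 2 is about 1.586. Both bounds are verified through this
  equation.\<close>

lemma quot_error_bounds:
  assumes "0 < u" "u \<le> 1/32"
  shows "(2 * sqrt 2 - 1) * u + 158 / 100 * u ^ 2 \<le> quot_error u" "quot_error u \<le> 1885 / 1000 * u"
proof -
  note E = z_error_bounds[OF assms]
  have pos: "1 + sqrt 2 - z_error u > 0" using E assms sqrt2_bounds by linarith
  have s2: "sqrt 2 * sqrt 2 = 2" "sqrt 2 * (sqrt 2 * a) = 2 * a" for a
    by (simp_all flip: mult.assoc)
  define L where "L = (2 * sqrt 2 - 1) * u + 158 / 100 * u ^ 2"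
  have "18284 / 10000 * u \<le> L" unfolding L_def using sqrt2_bounds assms
    by (intro add_increasing2 mult_right_mono) auto
  then have "(2 * u + 499 / 100 * u ^ 2) * (1 + 18284 / 10000 * u) \<le> z_error u * (1 + L)"
    using E assms by (intro mult_mono) auto
  moreover have "2 * u + 86467 / 10000 * u ^ 2 \<le> (2 * u + 499 / 100 * u ^ 2) * (1 + 18284 / 10000 * u)"
    using assms by (simp add: algebra_simps power2_eq_square)
  moreover have "(1 + sqrt 2) * (L - (u - 2 * u ^ 2)) = 2 * u + 358 / 100 * (1 + sqrt 2) * u ^ 2"
    unfolding L_def by (simp add: algebra_simps s2)
  moreover have "358 / 100 * (1 + sqrt 2) * u ^ 2 \<le> 86467 / 10000 * u ^ 2"
    using sqrt2_bounds by (intro mult_right_mono) auto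
  ultimately have "(1 + sqrt 2) * (L - (u - 2 * u ^ 2)) \<le> z_error u * (1 + L)" by linarith
  then have "L * (1 + sqrt 2 - z_error u) \<le> (u - 2 * u ^ 2) * (1 + sqrt 2) + z_error u"
    by (simp add: algebra_simps)
  then show "L \<le> quot_error u"
    unfolding quot_error_def using pos by (simp add: pos_le_divide_eq)
  have p: "u ^ 3 \<le> u ^ 2 / 32" "u ^ 2 \<le> u / 32"
    using small_power_bounds[of u] assms by auto
  have "z_error u * (1 + 1885 / 1000 * u) \<le> (2 * u + 5 * u ^ 2) * (1 + 1885 / 1000 * u)"
    using E assms by (intro mult_right_mono) auto
  also have "\<dots> = 2 * u + 877 / 100 * u ^ 2 + 9425 / 1000 * u ^ 3"
    by (simp add: field_simps eval_nat_numeral)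
  also have "\<dots> \<le> 2414213 / 1000000 * (885 / 1000 * u + 2 * u ^ 2)"
    using p assms by simp
  also have "\<dots> \<le> (1 + sqrt 2) * (885 / 1000 * u + 2 * u ^ 2)"
    using sqrt2_bounds assms by (intro mult_right_mono) auto
  finally have "(u - 2 * u ^ 2) * (1 + sqrt 2) + z_error u \<le> 1885 / 1000 * u * (1 + sqrt 2 - z_error u)"
    by (simp add: field_simps)
  then show "quot_error u \<le> 1885 / 1000 * u"
    unfolding quot_error_def using pos by (simp add: pos_divide_le_eq)
qed

text \<open>The formula for \<open>phi\<close> describes x = y = 1: the exact result is 1 + 1 / (1 +
  sqrt 2) = sqrt 2, of which the quotient is the fraction 1 / (2 + sqrt 2), and (1 + 2 u) / (1 + u)
  is the factor of the last rounding.\<close>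

lemma phi_eq:
  assumes "0 < u" "u \<le> 1/32"
  shows "phi u = (1 + u / (1 + u)) * (1 + quot_error u / (2 + sqrt 2)) - 1"
proof -
  define s where "s = sqrt 2"
  define E where "E = z_error u"
  define k where "k = u - 2 * u ^ 2"
  have s: "s * s = 2" "s > 0" by (simp_all add: s_def)
  have pos: "1 + s - E > 0"
    using z_error_bounds[OF assms] assms sqrt2_bounds unfolding s_def E_def by linarith
  have q: "(1 + s) * (s - 1) = 1" using s by (simp add: algebra_simps)
  then have "1 / (1 + s) = s - 1" using s by (simp add: field_simps)
  then have s': "1 + 1 / (1 + s) = s" by simp
  have "s * (s * a) = 2 * a" for a using s by (simp flip: mult.assoc)
  then have "(2 + s) * ((1 + s - E) + (1 + k)) = s * ((2 + s) * (1 + s - E) + (k * (1 + s) + E))"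
    using s by (simp add: algebra_simps)
  moreover have "(1 + c / Y) / s = 1 + N / Y / t"
    if "t * (Y + c) = s * (t * Y + N)" "Y > 0" "t > 0" for c Y N t
  proof -
    have "(1 + c / Y) / s = t * (Y + c) / (s * t * Y)"
      using that(2,3) s(2) by (simp add: field_simps)
    also have "\<dots> = 1 + N / Y / t"
      unfolding that(1) using that(2,3) s(2) by (simp add: field_simps)
    finally show ?thesis .
  qed
  ultimately have A: "(1 + (1 + k) / (1 + s - E)) / s = 1 + ((k * (1 + s) + E) / (1 + s - E)) / (2 + s)"
    using pos s(2) by simp
  have ku: "1 + u * (1 - 2 * u) = 1 + k" by (simp add: k_def algebra_simps power2_eq_square)
  have B: "(1 + 2 * u) / (1 + u) = 1 + u / (1 + u)"
    using assms by (simp add: field_simps)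
  have C: "phi u = (1 + (1 + k) / (1 + s - E)) / s * ((1 + 2 * u) / (1 + u)) - 1"
    unfolding phi_def z_error_def[symmetric] E_def[symmetric] s_def[symmetric] s' ku
    by (simp only: times_divide_times_eq)
  show ?thesis unfolding C A B by (simp only: quot_error_def k_def E_def s_def mult.commute)
qed

text \<open>With \<open>r = x / y\<close> the exact hypotenuse is \<open>y * (r + 1 / (r + sqrt (1 + r\<^sup>2)))\<close>. The two
  hypotheses on the computed \<open>z\<close> are the sharpest ones under which the last two roundings keep
  the error within \<open>phi u\<close>.\<close>
lemma final_steps_error:
  fixes r u z zz \<rho> :: real
  assumes u: "0 < u" "u \<le> 1/32" and "0 \<le> r" and "0 < z"
  defines "h \<equiv> sqrt (1 + r ^ 2)" and "k \<equiv> u - 2 * u ^ 2"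
  defines "g \<equiv> h * (r + h) / (2 + sqrt 2)"
  assumes g: "1 \<le> g"
    and lower: "(r + h) * (1 + k) \<le> z * (1 + quot_error u * g)"
    and upper: "z \<le> (r + h) * (1 + quot_error u * (1 + 2 * u) * g - k)"
    and zz: "\<bar>zz - 1 / z\<bar> \<le> k * (1 / z)"
    and \<rho>: "\<bar>\<rho> - (r + zz)\<bar> \<le> u / (1 + u) * \<bar>r + zz\<bar>"
  shows "\<bar>\<rho> / h - 1\<bar> \<le> phi u"
proof -
  define v where "v = u / (1 + u)"
  define X where "X = quot_error u"
  define b where "b = X / (2 + sqrt 2)"
  define G where "G = b * h * (r + h)"
  have h: "h > 0" "h ^ 2 = 1 + r ^ 2" "r \<le> h"
    using assms(3) by (auto simp: h_def add_pos_nonneg intro!: real_le_rsqrt)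
  have XG: "X * g = G" by (simp add: G_def b_def g_def)
  have z0: "r + h > 0" "(r + h) * (h - r) = 1"
    using h assms(3) by (auto simp: algebra_simps power2_eq_square)
  then have z0': "1 / (r + h) = h - r" by (simp add: field_simps)
  have u2: "u ^ 2 \<le> u / 32" using small_power_bounds[of u] u by simp
  have k: "0 \<le> k" "k < 1" using u2 u zero_le_power2[of u] unfolding k_def by linarith+
  have "1 * u \<le> (2 * sqrt 2 - 1) * u" using sqrt2_bounds u by (intro mult_right_mono) auto
  then have X: "u \<le> X" using quot_error_bounds[OF u] zero_le_power2[of u] unfolding X_def by linarith
  \<comment> \<open>By the third identity, a sum too small by the fraction (1 + 2 u) b and then
    rounded down by the fraction v loses v + (1 + v) b, which is exactly \<open>phi u\<close>. Hence
    the factor 1 + 2 u in \<open>upper\<close>.\<close>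
  have v: "0 < v" "v < 1" "(1 - v) * (1 + 2 * u) = 1 + v" using u by (auto simp: v_def field_simps)
  have phi: "phi u = (1 + v) * (1 + b) - 1" unfolding phi_eq[OF u] v_def b_def X_def ..
  have zpos: "(1 - k) / z > 0" "(1 - k) / z \<le> zz" "zz \<le> (1 + k) / z"
    using zz k assms(4) by (auto simp: abs_le_iff field_simps)
  have "(1 + k) / z \<le> (1 + G) / (r + h)"
    using lower z0 assms(4) unfolding X_def[symmetric] XG
    by (subst divide_le_eq) (auto simp: field_simps)
  also have "\<dots> = (1 + G) * (h - r)" using z0' by (simp add: divide_inverse)
  also have "\<dots> = h - r + b * h * ((r + h) * (h - r))" by (simp add: G_def algebra_simps)
  finally have "r + zz \<le> (1 + b) * h" using zpos z0 by (simp add: algebra_simps)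
  then have "(1 + v) * (r + zz) \<le> (1 + v) * ((1 + b) * h)" using v by (intro mult_left_mono) auto
  then have up: "\<rho> \<le> (1 + phi u) * h"
    using \<rho> zpos assms(3) unfolding phi v_def[symmetric] by (simp add: abs_le_iff algebra_simps)
  define G' where "G' = (1 + 2 * u) * G"
  have "u * 1 \<le> X * g" using X g u by (intro mult_mono) auto
  then have "G \<ge> u" by (simp add: XG)
  then have "(1 + 2 * u) * u \<le> G'" using u unfolding G'_def by (intro mult_left_mono) auto
  moreover have "u \<le> (1 + 2 * u) * u" using u by (simp add: algebra_simps)
  moreover have "k \<le> u" by (simp add: k_def)
  ultimately have G': "k \<le> G'" by linarith
  have "(1 - G') / (r + h) \<le> (1 - k) / z"
  \<comment> \<open>\<open>upper\<close> is linear in G', and (1 - G') (1 + G' - k) <= 1 - k because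
    0 <= k <= G'. Since g grows without bound with r, G' may exceed 1; then the left side is not
    positive.\<close>
  proof (cases "G' \<le> 1")
    case True
    have "(1 - G') * z \<le> (1 - G') * ((r + h) * (1 + G' - k))"
      using upper True unfolding X_def[symmetric]
      by (intro mult_left_mono) (auto simp: G'_def XG[symmetric] algebra_simps)
    also have "\<dots> = (r + h) * (1 - k - G' * (G' - k))" by (simp add: algebra_simps)
    also have "\<dots> \<le> (r + h) * (1 - k)" using G' k z0 by (intro mult_left_mono) auto
    finally show ?thesis using z0 assms(4) by (simp add: field_simps)
  next
    case False
    then have "(1 - G') / (r + h) \<le> 0" using z0 by (simp add: divide_nonpos_pos)
    then show ?thesis using zpos by linarith
  qed
  moreover have "(1 - G') / (r + h) = h - r - (1 + 2 * u) * b * h"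
  proof -
    have "(1 - G') / (r + h) = (1 - G') * (h - r)" using z0' by (simp add: divide_inverse)
    also have "\<dots> = h - r - (1 + 2 * u) * b * h * ((r + h) * (h - r))"
      by (simp add: G'_def G_def algebra_simps)
    finally show ?thesis using z0(2) by simp
  qed
  ultimately have "(1 - (1 + 2 * u) * b) * h \<le> r + zz" using zpos by (simp add: algebra_simps)
  then have "(1 - v) * ((1 - (1 + 2 * u) * b) * h) \<le> (1 - v) * (r + zz)"
    using v by (intro mult_left_mono) auto
  moreover have "(1 - v) * ((1 - (1 + 2 * u) * b) * h) = (1 - v - ((1 - v) * (1 + 2 * u)) * b) * h"
    by (simp add: algebra_simps)
  moreover have "(1 - v - (1 + v) * b) * h = (1 - phi u) * h" unfolding phi by (simp add: algebra_simps)
  ultimately have "(1 - phi u) * h \<le> (1 - v) * (r + zz)" using v(3) by simp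
  then have lo: "(1 - phi u) * h \<le> \<rho>"
    using \<rho> zpos assms(3) unfolding v_def[symmetric] by (simp add: abs_le_iff algebra_simps)
  show ?thesis using up lo h by (simp add: abs_le_iff field_simps)
qed

section \<open>The branch near x = y\<close>

text \<open>\<open>r3\<close> occurs in the numerator of r3 / d and again inside d under a square
  root. Monotonicity of the whole quotient moves \<open>r3\<close> to an end point of its range; the
  root can then be replaced by its exact value in the safe direction, so the error of
  \<open>r3\<close> is charged to the numerator only.\<close>

lemma quotient_sqrt_mono:
  fixes a b A B :: real
  assumes "0 \<le> a" "a \<le> b" "0 < A" "0 < B"
  shows "a / (A + B * sqrt (2 + a)) \<le> b / (A + B * sqrt (2 + b))"
proof -
  have pos: "A + B * sqrt (2 + a) > 0" "A + B * sqrt (2 + b) > 0"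
    using assms by (auto intro!: add_pos_nonneg)
  have "a * a \<le> b * b" "a * a * b \<le> b * b * a"
    using assms mult_mono[of a b a b] mult_mono[of "a * b" "a * b" a b]
    by (auto simp: algebra_simps)
  then have "a\<^sup>2 * (2 + b) \<le> b\<^sup>2 * (2 + a)"
    by (simp add: algebra_simps power2_eq_square)
  then have "sqrt (a\<^sup>2 * (2 + b)) \<le> sqrt (b\<^sup>2 * (2 + a))" by (rule real_sqrt_le_mono)
  then have "a * sqrt (2 + b) \<le> b * sqrt (2 + a)" using assms by (simp add: real_sqrt_mult)
  then have "B * (a * sqrt (2 + b)) \<le> B * (b * sqrt (2 + a))" using assms by (intro mult_left_mono) auto
  moreover have "a * A \<le> b * A" using assms by (intro mult_right_mono) auto
  ultimately have "a * (A + B * sqrt (2 + b)) \<le> b * (A + B * sqrt (2 + a))"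
    by (simp add: algebra_simps)
  then show ?thesis using pos by (simp add: field_simps)
qed

definition hyp_gap :: "real \<Rightarrow> real" where
  "hyp_gap w = sqrt (1 + (1 + w) ^ 2) - sqrt 2"

text \<open>The identity behind the second branch: h - sqrt 2 = (h^2 - 2) / (h + sqrt 2), which the
  algorithm approximates by r3 / d.\<close>

lemma hyp_gap_mult: "hyp_gap w * (2 * sqrt 2 + hyp_gap w) = 2 * w + w ^ 2"
proof -
  have "hyp_gap w * (2 * sqrt 2 + hyp_gap w) = sqrt (1 + (1 + w) ^ 2) ^ 2 - sqrt 2 ^ 2"
    by (simp add: hyp_gap_def algebra_simps power2_eq_square)
  also have "\<dots> = (1 + (1 + w) ^ 2) - 2" by (simp add: add_nonneg_nonneg)
  finally show ?thesis by (simp add: power2_eq_square algebra_simps)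
qed

text \<open>h is convex in w, with slope 1 / sqrt 2 at 0 and mean slope sqrt 5 - sqrt 2 < 0.822 on
  [0, 1]. The last bound is the second-order Taylor polynomial, whose quadratic coefficient is 1 /
  (4 sqrt 2), rounded up.\<close>

lemma hyp_gap_bounds:
  assumes "0 \<le> w" "w \<le> 1"
  shows "7071 / 10000 * w \<le> hyp_gap w" "hyp_gap w \<le> 822 / 1000 * w"
    and "hyp_gap w \<le> 70711 / 100000 * w + 17678 / 100000 * w ^ 2"
proof -
  have e: "(sqrt 2 + c) ^ 2 = 2 + 2 * (sqrt 2 * c) + c ^ 2" for c
    by (simp add: power2_eq_square algebra_simps)
  have e': "1 + (1 + w) ^ 2 = 2 + 2 * w + w ^ 2" by (simp add: power2_eq_square algebra_simps)
  have w2: "0 \<le> w ^ 2" "w ^ 2 \<le> w" using assms mult_left_mono[of w 1 w] by (auto simp: power2_eq_square)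
  have "sqrt 2 * (7071 / 10000 * w) \<le> 1414214 / 1000000 * (7071 / 10000 * w)"
    using sqrt2_bounds assms by (intro mult_right_mono) auto
  moreover have "(7071 / 10000 * w) ^ 2 = 49999041 / 100000000 * w ^ 2"
    by (simp add: power_mult_distrib power_divide)
  ultimately have "(sqrt 2 + 7071 / 10000 * w) ^ 2 \<le> 1 + (1 + w) ^ 2"
    unfolding e e' using w2 assms by linarith
  then have "sqrt 2 + 7071 / 10000 * w \<le> sqrt (1 + (1 + w) ^ 2)" by (rule real_le_rsqrt)
  then show "7071 / 10000 * w \<le> hyp_gap w" by (simp add: hyp_gap_def)
  have "1414213 / 1000000 * (822 / 1000 * w) \<le> sqrt 2 * (822 / 1000 * w)"
    using sqrt2_bounds assms by (intro mult_right_mono) auto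
  moreover have "(822 / 1000 * w) ^ 2 = 675684 / 1000000 * w ^ 2"
    by (simp add: power_mult_distrib power_divide)
  ultimately have F: "1 + (1 + w) ^ 2 \<le> (sqrt 2 + 822 / 1000 * w) ^ 2"
    unfolding e e' using w2 assms by linarith
  have "sqrt (1 + (1 + w) ^ 2) \<le> sqrt 2 + 822 / 1000 * w"
    by (rule real_le_lsqrt[OF _ F]) (use assms in simp)
  then show "hyp_gap w \<le> 822 / 1000 * w" by (simp add: hyp_gap_def)
  define c where "c = 70711 / 100000 * w + 17678 / 100000 * w ^ 2"
  have c: "0 \<le> c" "70711 / 100000 * w \<le> c" using assms by (auto simp: c_def)
  have "1414213 / 1000000 * c \<le> sqrt 2 * c"
    using sqrt2_bounds c by (intro mult_right_mono) auto
  moreover have "(70711 / 100000 * w) ^ 2 \<le> c ^ 2" using c assms by (intro power_mono) auto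
  moreover have "1414213 / 1000000 * c = 100000415443 / 100000000000 * w + 25000457414 / 100000000000 * w ^ 2"
    by (simp add: c_def field_simps)
  moreover have "(70711 / 100000 * w) ^ 2 = 5000045521 / 10000000000 * w ^ 2"
    by (simp add: power_mult_distrib power_divide)
  ultimately have F: "1 + (1 + w) ^ 2 \<le> (sqrt 2 + c) ^ 2"
    unfolding e e' using w2 assms by linarith
  have "sqrt (1 + (1 + w) ^ 2) \<le> sqrt 2 + c"
    by (rule real_le_lsqrt[OF _ F]) (use c in simp)
  then show "hyp_gap w \<le> 70711 / 100000 * w + 17678 / 100000 * w ^ 2" by (simp add: hyp_gap_def c_def)
qed

text \<open>The roundings of the second branch, with \<open>w = (x - y) / y\<close>. The slope \<open>1.71\<close> makes the bound
  on \<open>s2\<close> reach \<open>2 * u\<close> at \<open>sqrt r4 = 2\<close>, where the spacing of the floats doubles.\<close>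
locale near_one_run =
  fixes u w Ph Pl R2 r2 r3 r4 s2 d q r5 r6 :: real
  assumes u: "0 < u" "u \<le> 1/32"
    and w: "0 \<le> w" "w \<le> 1"
    and Ph: "\<bar>Ph + Pl - (1 + sqrt 2)\<bar> \<le> u ^ 2"
    and Pl: "\<bar>Pl\<bar> \<le> 2 * u"
    and R2: "\<bar>R2 - sqrt 2\<bar> \<le> u"
    and r2: "\<bar>r2 - w\<bar> \<le> (u - 2 * u ^ 2) * w"
    and r3: "\<bar>r3 - (2 * r2 + r2 ^ 2)\<bar> \<le> u / (1 + u) * \<bar>2 * r2 + r2 ^ 2\<bar>"
    and r4: "\<bar>r4 - (2 + r3)\<bar> \<le> u / (1 + u) * \<bar>2 + r3\<bar>"
    and s2: "\<bar>s2 - sqrt r4\<bar> \<le> u * (1 + 171 / 100 * (sqrt r4 - sqrt 2))"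
    and d: "\<bar>d - (R2 + s2)\<bar> \<le> 2 * u"
    and q: "\<bar>q - r3 / d\<bar> \<le> u / (1 + u) * \<bar>r3 / d\<bar>"
    and r5: "\<bar>r5 - (Pl + q)\<bar> \<le> u / (1 + u) * \<bar>Pl + q\<bar>"
    and r6: "\<bar>r6 - (r5 + r2)\<bar> \<le> u / (1 + u) * \<bar>r5 + r2\<bar>"
begin

section \<open>Roundings up to the quotient r3 / d\<close>

definition "v = u / (1 + u)"
definition "k = u - 2 * u ^ 2"
definition "m = hyp_gap w"
definition "D = 2 * sqrt 2 + m"

text \<open>v = u (1 - v), and v >= (32/33) u > 0.968 u on the given range of u.\<close>

lemma v_bounds: "0 < v" "v < 1" "v \<le> u" "v \<le> u * (1 - 968 / 1000 * u)" "1 - v = 1 / (1 + u)"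
proof -
  show "0 < v" "v < 1" "1 - v = 1 / (1 + u)" using u by (auto simp: v_def field_simps)
  have "u ^ 3 \<le> u ^ 2 / 32" "0 \<le> u ^ 2" using small_power_bounds[of u] u by auto
  then have "u \<le> u + 32 / 1000 * u ^ 2 - 968 / 1000 * u ^ 3" by linarith
  also have "\<dots> = u * (1 - 968 / 1000 * u) * (1 + u)" by (simp add: field_simps eval_nat_numeral)
  finally show "v \<le> u * (1 - 968 / 1000 * u)" using u by (simp add: v_def pos_divide_le_eq)
  show "v \<le> u" using u by (simp add: v_def pos_divide_le_eq)
qed

lemma k_bounds: "0 \<le> k" "k \<le> u" "k \<le> 1/32"
  using small_power_bounds[of u] u zero_le_power2[of u] unfolding k_def by linarith+

lemma m_bounds: "7071 / 10000 * w \<le> m" "m \<le> 822 / 1000 * w" "m \<le> 70711 / 100000 * w + 17678 / 100000 * w ^ 2" "0 \<le> m"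
  using hyp_gap_bounds[OF w] w unfolding m_def by (auto intro: order_trans[rotated])

lemma m_D: "m * D = 2 * w + w ^ 2"
  using hyp_gap_mult[of w] by (simp add: m_def D_def)

lemma D_pos: "2828426 / 1000000 \<le> D" "D > 0"
  using m_bounds sqrt2_bounds unfolding D_def by linarith+

lemma sqrt_T: "sqrt (2 + (2 * w + w ^ 2)) = sqrt 2 + m"
proof -
  have "2 + (2 * w + w ^ 2) = 1 + (1 + w) ^ 2" by (simp add: power2_eq_square algebra_simps)
  then show ?thesis by (simp add: m_def hyp_gap_def)
qed

lemma r2_bounds: "w * (1 - k) \<le> r2" "r2 \<le> w * (1 + k)" "0 \<le> r2"
proof -
  show *: "w * (1 - k) \<le> r2" "r2 \<le> w * (1 + k)"
    using r2 unfolding k_def[symmetric] by (auto simp: abs_le_iff algebra_simps)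
  have "0 \<le> w * (1 - k)" using w k_bounds by (intro mult_nonneg_nonneg) auto
  then show "0 \<le> r2" using * by linarith
qed

definition "r3lo = (1 - v) * (2 * w + w ^ 2 - 2 * k * (w + w ^ 2))"
definition "r3hi = (1 + v) * (2 * w + w ^ 2 + 2 * k * (w + w ^ 2) + k ^ 2 * w ^ 2)"

lemma r3_bounds: "r3lo \<le> r3" "r3 \<le> r3hi" "0 \<le> r3lo" "r3lo \<le> 2 * w + w ^ 2" "2 * w + w ^ 2 \<le> r3hi" "0 \<le> r3"
proof -
  have e: "\<bar>2 * r2 + r2 ^ 2\<bar> = 2 * r2 + r2 ^ 2" using r2_bounds by simp
  have r3': "(1 - v) * (2 * r2 + r2 ^ 2) \<le> r3" "r3 \<le> (1 + v) * (2 * r2 + r2 ^ 2)"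
    using r3 unfolding e v_def[symmetric] by (auto simp: abs_le_iff algebra_simps)
  have "0 \<le> w * (1 - k)" using w k_bounds by (intro mult_nonneg_nonneg) auto
  then have "(w * (1 - k)) ^ 2 \<le> r2 ^ 2" using r2_bounds by (intro power_mono) auto
  moreover have "(w * (1 - k)) ^ 2 = w ^ 2 * (1 - 2 * k) + (w * k) ^ 2"
    by (simp add: power2_eq_square algebra_simps)
  ultimately have "w ^ 2 * (1 - 2 * k) \<le> r2 ^ 2" using zero_le_power2[of "w * k"] by linarith
  then have "2 * w + w ^ 2 - 2 * k * (w + w ^ 2) \<le> 2 * r2 + r2 ^ 2"
    using r2_bounds by (simp add: algebra_simps)
  then have "r3lo \<le> (1 - v) * (2 * r2 + r2 ^ 2)" unfolding r3lo_def
    using v_bounds by (intro mult_left_mono) auto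
  then show a: "r3lo \<le> r3" using r3' by linarith
  have "r2 ^ 2 \<le> (w * (1 + k)) ^ 2" using r2_bounds by (intro power_mono) auto
  then have "2 * r2 + r2 ^ 2 \<le> 2 * w + w ^ 2 + 2 * k * (w + w ^ 2) + k ^ 2 * w ^ 2"
    using r2_bounds by (simp add: algebra_simps power2_eq_square)
  then have "(1 + v) * (2 * r2 + r2 ^ 2) \<le> r3hi" unfolding r3hi_def
    using v_bounds by (intro mult_left_mono) auto
  then show "r3 \<le> r3hi" using r3' by linarith
  have kw: "0 \<le> k * (w + w ^ 2)" "k * (w + w ^ 2) \<le> 1/32 * (w + w ^ 2)" "0 \<le> k ^ 2 * w ^ 2" "0 \<le> 2 * k * (w + w ^ 2)"
    by (intro mult_nonneg_nonneg mult_right_mono; use k_bounds w in simp)+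
  then have T: "0 \<le> 2 * w + w ^ 2 - 2 * k * (w + w ^ 2)" "0 \<le> 2 * w + w ^ 2"
    using w zero_le_power2[of w] by auto
  then show b: "0 \<le> r3lo" unfolding r3lo_def using v_bounds by (intro mult_nonneg_nonneg) auto
  have "r3lo \<le> 1 * (2 * w + w ^ 2 - 2 * k * (w + w ^ 2))" unfolding r3lo_def
    using v_bounds T by (intro mult_right_mono) auto
  then show "r3lo \<le> 2 * w + w ^ 2" using kw by simp
  have "1 * (2 * w + w ^ 2 + 2 * k * (w + w ^ 2) + k ^ 2 * w ^ 2) \<le> r3hi" unfolding r3hi_def
    using v_bounds T kw by (intro mult_right_mono) auto
  then show "2 * w + w ^ 2 \<le> r3hi" using kw unfolding mult_1 by linarith
  show "0 \<le> r3" using a b by linarith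
qed

text \<open>The square root halves the relative error. That 1 - u / 2 works on the lower side relies
  on v = u / (1 + u): (1 - u / 2)^2 (1 + u) <= 1.\<close>

lemma sqrt_r4_bounds:
  "sqrt r4 \<le> (1 + u / 2) * sqrt (2 + r3)" "(1 - u / 2) * sqrt (2 + r3) \<le> sqrt r4"
proof -
  have r4': "(1 - v) * (2 + r3) \<le> r4" "r4 \<le> (1 + v) * (2 + r3)"
    using r4 r3_bounds unfolding v_def[symmetric] by (auto simp: abs_le_iff algebra_simps)
  have p: "u ^ 3 \<le> u ^ 2 / 32" "0 \<le> u ^ 2" using small_power_bounds[of u] u by auto
  have "(1 + u / 2) ^ 2 = 1 + u + u ^ 2 / 4" by (simp add: power2_eq_square field_simps)
  then have "1 + v \<le> (1 + u / 2) ^ 2" using v_bounds(3) p by linarith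
  then have "(1 + v) * (2 + r3) \<le> (1 + u / 2) ^ 2 * (2 + r3)"
    using r3_bounds by (intro mult_right_mono) auto
  then have "r4 \<le> (1 + u / 2) ^ 2 * (2 + r3)" using r4' by linarith
  then have "sqrt r4 \<le> sqrt ((1 + u / 2) ^ 2 * (2 + r3))" by (rule real_sqrt_le_mono)
  then show "sqrt r4 \<le> (1 + u / 2) * sqrt (2 + r3)" using u by (simp add: real_sqrt_mult)
  have "(1 - u / 2) ^ 2 * (1 + u) = 1 - 3 / 4 * u ^ 2 + u ^ 3 / 4"
    by (simp add: power2_eq_square eval_nat_numeral field_simps)
  then have "(1 - u / 2) ^ 2 * (1 + u) \<le> 1" using p by linarith
  then have "(1 - u / 2) ^ 2 \<le> 1 - v" unfolding v_bounds(5) using u by (simp add: pos_le_divide_eq)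
  then have "(1 - u / 2) ^ 2 * (2 + r3) \<le> (1 - v) * (2 + r3)"
    using r3_bounds by (intro mult_right_mono) auto
  then have "(1 - u / 2) ^ 2 * (2 + r3) \<le> r4" using r4' by linarith
  then have "sqrt ((1 - u / 2) ^ 2 * (2 + r3)) \<le> sqrt r4" by (rule real_sqrt_le_mono)
  then show "(1 - u / 2) * sqrt (2 + r3) \<le> sqrt r4" using u by (simp add: real_sqrt_mult)
qed

text \<open>Relative error of d to first order, in units of u. At w = 0 the roundings of
  \<open>R2\<close>, \<open>s2\<close> and \<open>d\<close> contribute 1 + 1 + 2 and that of
  \<open>r4\<close> contributes sqrt 2 / 2, out of d = 2 sqrt 2; the quotient sqrt 2 + 1/4 lies just
  below 1.6643. The slope 0.16 covers the growth with w.\<close>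

definition "\<epsilon> = 16643 / 10000 + 16 / 100 * w"

lemma s2_bounds:
  "s2 \<le> sqrt r4 + u * (1 + 171 / 100 * (sqrt r4 - sqrt 2))"
  "sqrt r4 - u * (1 + 171 / 100 * (sqrt r4 - sqrt 2)) \<le> s2"
  using s2 by (auto simp only: abs_le_iff)

text \<open>Both bounds are brought to the shape A + B * sqrt (2 + r3) that
  \<open>quotient_sqrt_mono\<close> handles.\<close>

lemma d_bounds:
  "d \<le> (sqrt 2 * (1 - 171 / 100 * u) + 4 * u) + ((1 + 171 / 100 * u) * (1 + u / 2)) * sqrt (2 + r3)"
  "(sqrt 2 * (1 + 171 / 100 * u) - 4 * u) + ((1 - 171 / 100 * u) * (1 - u / 2)) * sqrt (2 + r3) \<le> d"
proof -
  have "(1 + 171 / 100 * u) * sqrt r4 \<le> (1 + 171 / 100 * u) * ((1 + u / 2) * sqrt (2 + r3))"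
    using u sqrt_r4_bounds by (intro mult_left_mono) auto
  then show "d \<le> (sqrt 2 * (1 - 171 / 100 * u) + 4 * u) + ((1 + 171 / 100 * u) * (1 + u / 2)) * sqrt (2 + r3)"
    using d s2_bounds R2 by (simp add: abs_le_iff field_simps)
  have "(1 - 171 / 100 * u) * ((1 - u / 2) * sqrt (2 + r3)) \<le> (1 - 171 / 100 * u) * sqrt r4"
    using u sqrt_r4_bounds by (intro mult_left_mono) auto
  then show "(sqrt 2 * (1 + 171 / 100 * u) - 4 * u) + ((1 - 171 / 100 * u) * (1 - u / 2)) * sqrt (2 + r3) \<le> d"
    using d s2_bounds R2 by (simp add: abs_le_iff field_simps)
qed

lemma denominator_bounds:
  "(sqrt 2 * (1 - 171 / 100 * u) + 4 * u) + ((1 + 171 / 100 * u) * (1 + u / 2)) * (sqrt 2 + m) \<le> D * (1 + u * (\<epsilon> + 54 / 100 * u))"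
  "D * (1 - u * \<epsilon>) \<le> (sqrt 2 * (1 + 171 / 100 * u) - 4 * u) + ((1 - 171 / 100 * u) * (1 - u / 2)) * (sqrt 2 + m)"
proof -
  have wm: "0 \<le> w * m" "0 \<le> u * m" "0 \<le> u ^ 2" using w m_bounds u by auto
  have s: "1414213 / 1000000 * w \<le> sqrt 2 * w" "1414213 / 1000000 * u \<le> sqrt 2 * u"
    by (intro mult_right_mono; use sqrt2_bounds w u in simp)+
  have eD: "\<epsilon> * D = 2 * 16643 / 10000 * sqrt 2 + 32 / 100 * (sqrt 2 * w) + 16643 / 10000 * m + 16 / 100 * (w * m)"
    by (simp add: \<epsilon>_def D_def field_simps)
  have e1: "4 - 171 / 100 * sqrt 2 + 221 / 100 * (sqrt 2 + m) \<le> \<epsilon> * D"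
    unfolding eD distrib_left using wm s m_bounds sqrt2_bounds by linarith
  \<comment> \<open>0.855 = 1.71 / 2 comes from the product of the error of \<open>s2\<close> with
    that of its argument. The resulting u^2 term only hurts the upper bound on d; in the lower bound
    it has the favourable sign.\<close>
  have e2: "855 / 1000 * (sqrt 2 + m) \<le> 54 / 100 * D"
    using m_bounds w sqrt2_bounds unfolding D_def distrib_left by linarith
  have a1: "u * (4 - 171 / 100 * sqrt 2 + 221 / 100 * (sqrt 2 + m)) \<le> u * (\<epsilon> * D)"
    using e1 u by (intro mult_left_mono) auto
  have a2: "u ^ 2 * (855 / 1000 * (sqrt 2 + m)) \<le> u ^ 2 * (54 / 100 * D)"
    using e2 wm by (intro mult_left_mono) auto
  have a3: "0 \<le> u ^ 2 * (855 / 1000 * (sqrt 2 + m))" using m_bounds by simp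
  have b1: "(sqrt 2 * (1 - 171 / 100 * u) + 4 * u) + ((1 + 171 / 100 * u) * (1 + u / 2)) * (sqrt 2 + m)
    = D + u * (4 - 171 / 100 * sqrt 2 + 221 / 100 * (sqrt 2 + m)) + u ^ 2 * (855 / 1000 * (sqrt 2 + m))"
    by (simp add: D_def field_simps power2_eq_square)
  have b2: "(sqrt 2 * (1 + 171 / 100 * u) - 4 * u) + ((1 - 171 / 100 * u) * (1 - u / 2)) * (sqrt 2 + m)
    = D - u * (4 - 171 / 100 * sqrt 2 + 221 / 100 * (sqrt 2 + m)) + u ^ 2 * (855 / 1000 * (sqrt 2 + m))"
    by (simp add: D_def field_simps power2_eq_square)
  have b3: "D * (1 + u * (\<epsilon> + 54 / 100 * u)) = D + u * (\<epsilon> * D) + u ^ 2 * (54 / 100 * D)"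
    by (simp add: field_simps power2_eq_square)
  have b4: "D * (1 - u * \<epsilon>) = D - u * (\<epsilon> * D)" by (simp add: field_simps)
  show "(sqrt 2 * (1 - 171 / 100 * u) + 4 * u) + ((1 + 171 / 100 * u) * (1 + u / 2)) * (sqrt 2 + m) \<le> D * (1 + u * (\<epsilon> + 54 / 100 * u))"
    unfolding b1 b3 using a1 a2 by linarith
  show "D * (1 - u * \<epsilon>) \<le> (sqrt 2 * (1 + 171 / 100 * u) - 4 * u) + ((1 - 171 / 100 * u) * (1 - u / 2)) * (sqrt 2 + m)"
    unfolding b2 b4 using a1 a3 by linarith
qed

lemma \<epsilon>_bounds: "0 < \<epsilon>" "\<epsilon> \<le> 18243 / 10000" "u * \<epsilon> \<le> 6 / 100"
proof -
  show e: "0 < \<epsilon>" "\<epsilon> \<le> 18243 / 10000" using w unfolding \<epsilon>_def by auto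
  have "u * \<epsilon> \<le> 1/32 * (18243 / 10000)" using u e by (intro mult_mono) auto
  then show "u * \<epsilon> \<le> 6 / 100" by simp
qed

lemma r3_over_d_bounds:
  "r3lo / (D * (1 + u * (\<epsilon> + 54 / 100 * u))) \<le> r3 / d" "r3 / d \<le> r3hi / (D * (1 - u * \<epsilon>))" "0 < d"
proof -
  have s: "sqrt 2 + m = sqrt (2 + (2 * w + w ^ 2))" by (simp add: sqrt_T)
  have us: "sqrt 2 * u \<le> 1414214 / 1000000 * u" "sqrt 2 * u \<le> sqrt 2 * (1/32)" "0 \<le> sqrt 2 * u"
    by (intro mult_right_mono mult_left_mono mult_nonneg_nonneg; use sqrt2_bounds u in simp)+
  have A: "0 < sqrt 2 * (1 - 171 / 100 * u) + 4 * u" "0 < sqrt 2 * (1 + 171 / 100 * u) - 4 * u"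
    using u us sqrt2_bounds unfolding right_diff_distrib distrib_left by linarith+
  have B: "0 < (1 + 171 / 100 * u) * (1 + u / 2)" "0 < (1 - 171 / 100 * u) * (1 - u / 2)"
    "0 < 1 + 171 / 100 * u" "0 < 1 + u / 2" "0 < 1 - 171 / 100 * u" "0 < 1 - u / 2"
    using u by auto
  have R: "0 < sqrt (2 + r3)" "0 < sqrt (2 + r3lo)" "0 < sqrt (2 + r3hi)" "0 < sqrt 2 + m"
    using r3_bounds m_bounds by (auto intro!: add_pos_nonneg)
  have dpos: "0 < (sqrt 2 * (1 + 171 / 100 * u) - 4 * u) + ((1 - 171 / 100 * u) * (1 - u / 2)) * sqrt (2 + r3)"
    using A B R by (intro add_pos_pos mult_pos_pos) auto
  then show d0: "0 < d" using d_bounds(2) by linarith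
  have "r3lo / (D * (1 + u * (\<epsilon> + 54 / 100 * u)))
      \<le> r3lo / ((sqrt 2 * (1 - 171 / 100 * u) + 4 * u) + ((1 + 171 / 100 * u) * (1 + u / 2)) * (sqrt 2 + m))"
    using denominator_bounds(1) r3_bounds
    by (intro divide_left_mono) (use A B R in \<open>auto intro!: mult_pos_pos add_pos_pos D_pos \<epsilon>_bounds u\<close>)
  also have "\<dots> \<le> r3lo / ((sqrt 2 * (1 - 171 / 100 * u) + 4 * u) + ((1 + 171 / 100 * u) * (1 + u / 2)) * sqrt (2 + r3lo))"
    unfolding s using r3_bounds A B R u
    by (intro divide_left_mono add_left_mono mult_left_mono mult_pos_pos add_pos_pos) auto
  also have "\<dots> \<le> r3 / ((sqrt 2 * (1 - 171 / 100 * u) + 4 * u) + ((1 + 171 / 100 * u) * (1 + u / 2)) * sqrt (2 + r3))"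
    using r3_bounds A B u by (intro quotient_sqrt_mono) auto
  also have "\<dots> \<le> r3 / d"
    using r3_bounds A B R d0 u d_bounds(1) by (intro divide_left_mono mult_pos_pos add_pos_pos) auto
  finally show "r3lo / (D * (1 + u * (\<epsilon> + 54 / 100 * u))) \<le> r3 / d" .
  have "r3 / d \<le> r3 / ((sqrt 2 * (1 + 171 / 100 * u) - 4 * u) + ((1 - 171 / 100 * u) * (1 - u / 2)) * sqrt (2 + r3))"
    using r3_bounds dpos d0 d_bounds(2) by (intro divide_left_mono mult_pos_pos) auto
  also have "\<dots> \<le> r3hi / ((sqrt 2 * (1 + 171 / 100 * u) - 4 * u) + ((1 - 171 / 100 * u) * (1 - u / 2)) * sqrt (2 + r3hi))"
    using r3_bounds A B u by (intro quotient_sqrt_mono) auto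
  also have "\<dots> \<le> r3hi / ((sqrt 2 * (1 + 171 / 100 * u) - 4 * u) + ((1 - 171 / 100 * u) * (1 - u / 2)) * (sqrt 2 + m))"
    unfolding s using r3_bounds A B R[unfolded s] u
    by (intro divide_left_mono add_left_mono mult_left_mono mult_pos_pos add_pos_pos) auto
  also have "\<dots> \<le> r3hi / (D * (1 - u * \<epsilon>))"
    using denominator_bounds(2) r3_bounds A B R D_pos \<epsilon>_bounds u
      add_pos_pos[OF A(2) mult_pos_pos[OF B(2) R(4)]]
    by (intro divide_left_mono mult_pos_pos) auto
  finally show "r3 / d \<le> r3hi / (D * (1 - u * \<epsilon>))" .
qed

lemma q_bounds: "(1 - v) * (r3 / d) \<le> q" "q \<le> (1 + v) * (r3 / d)" "0 \<le> q"
proof -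
  have "0 \<le> r3 / d" using r3_bounds r3_over_d_bounds by simp
  then show *: "(1 - v) * (r3 / d) \<le> q" "q \<le> (1 + v) * (r3 / d)"
    using q unfolding v_def[symmetric] abs_of_nonneg[OF \<open>0 \<le> r3 / d\<close>]
    unfolding abs_le_iff left_diff_distrib distrib_right by linarith+
  have "0 \<le> (1 - v) * (r3 / d)" using \<open>0 \<le> r3 / d\<close> v_bounds by (intro mult_nonneg_nonneg) auto
  then show "0 \<le> q" using * by linarith
qed

text \<open>\<open>Pl\<close> is kept apart from its two rounding errors, so that it later combines
  with \<open>Ph\<close> and leaves only u^2.\<close>

lemma r6_bounds:
  "Pl - 2 * u * (2 * v + v ^ 2) + (1 - v) ^ 2 * q + (1 - v) * r2 \<le> r6"
  "r6 \<le> Pl + 2 * u * (2 * v + v ^ 2) + (1 + v) ^ 2 * q + (1 + v) * r2"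
proof -
  \<comment> \<open>As v < 1, the extreme outcomes of a rounding are monotone in its argument.
    Extreme values of \<open>r5\<close> therefore give extreme values of \<open>r6\<close>, whatever
    the sign of Pl + q.\<close>
  have mono: "x - v * \<bar>x\<bar> \<le> y - v * \<bar>y\<bar>" "x + v * \<bar>x\<bar> \<le> y + v * \<bar>y\<bar>" if "x \<le> y" for x y
  proof -
    have "v * \<bar>y - x\<bar> \<le> 1 * \<bar>y - x\<bar>" using v_bounds by (intro mult_right_mono) auto
    moreover have "v * \<bar>y\<bar> \<le> v * (\<bar>x\<bar> + \<bar>y - x\<bar>)" "v * \<bar>x\<bar> \<le> v * (\<bar>y\<bar> + \<bar>y - x\<bar>)"
      using v_bounds by (auto intro!: mult_left_mono)
    ultimately show "x - v * \<bar>x\<bar> \<le> y - v * \<bar>y\<bar>" "x + v * \<bar>x\<bar> \<le> y + v * \<bar>y\<bar>"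
      using that by (auto simp: algebra_simps)
  qed
  have Plv: "(2 * v + v ^ 2) * \<bar>Pl\<bar> \<le> (2 * v + v ^ 2) * (2 * u)"
    using Pl v_bounds by (intro mult_left_mono) auto
  have tri: "v * \<bar>Pl + q\<bar> \<le> v * (\<bar>Pl\<bar> + q)" using v_bounds q_bounds by (intro mult_left_mono) auto
  have "Pl - v * \<bar>Pl\<bar> + (1 - v) * q \<le> r5"
    using r5 tri unfolding v_def[symmetric] by (simp add: abs_le_iff algebra_simps)
  then have "(Pl - v * \<bar>Pl\<bar> + (1 - v) * q + r2) - v * \<bar>Pl - v * \<bar>Pl\<bar> + (1 - v) * q + r2\<bar> \<le> r6"
    using r6 mono(1)[of "Pl - v * \<bar>Pl\<bar> + (1 - v) * q + r2" "r5 + r2"]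
    unfolding v_def[symmetric] by (simp add: abs_le_iff)
  moreover have "v * \<bar>Pl - v * \<bar>Pl\<bar> + (1 - v) * q + r2\<bar> \<le> v * (\<bar>Pl\<bar> + v * \<bar>Pl\<bar> + (1 - v) * q + r2)"
  proof (intro mult_left_mono)
    have "0 \<le> (1 - v) * q" "0 \<le> v * \<bar>Pl\<bar>" using v_bounds q_bounds by auto
    then show "\<bar>Pl - v * \<bar>Pl\<bar> + (1 - v) * q + r2\<bar> \<le> \<bar>Pl\<bar> + v * \<bar>Pl\<bar> + (1 - v) * q + r2"
      using r2_bounds by linarith
  qed (use v_bounds in auto)
  ultimately show "Pl - 2 * u * (2 * v + v ^ 2) + (1 - v) ^ 2 * q + (1 - v) * r2 \<le> r6"
    using Plv by (simp add: algebra_simps power2_eq_square)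
  have "r5 \<le> Pl + v * \<bar>Pl\<bar> + (1 + v) * q"
    using r5 tri unfolding v_def[symmetric] by (simp add: abs_le_iff algebra_simps)
  then have "r6 \<le> (Pl + v * \<bar>Pl\<bar> + (1 + v) * q + r2) + v * \<bar>Pl + v * \<bar>Pl\<bar> + (1 + v) * q + r2\<bar>"
    using r6 mono(2)[of "r5 + r2" "Pl + v * \<bar>Pl\<bar> + (1 + v) * q + r2"]
    unfolding v_def[symmetric] by (simp add: abs_le_iff)
  moreover have "v * \<bar>Pl + v * \<bar>Pl\<bar> + (1 + v) * q + r2\<bar> \<le> v * (\<bar>Pl\<bar> + v * \<bar>Pl\<bar> + (1 + v) * q + r2)"
  proof (intro mult_left_mono)
    have "0 \<le> (1 + v) * q" "0 \<le> v * \<bar>Pl\<bar>" using v_bounds q_bounds by auto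
    then show "\<bar>Pl + v * \<bar>Pl\<bar> + (1 + v) * q + r2\<bar> \<le> \<bar>Pl\<bar> + v * \<bar>Pl\<bar> + (1 + v) * q + r2"
      using r2_bounds by linarith
  qed (use v_bounds in auto)
  ultimately show "r6 \<le> Pl + 2 * u * (2 * v + v ^ 2) + (1 + v) ^ 2 * q + (1 + v) * r2"
    using Plv by (simp add: algebra_simps power2_eq_square)
qed


text \<open>The budget in units of u: 2 w for the roundings of \<open>r2\<close> and
  \<open>r6\<close> acting on w; m (\<epsilon> + 0.54 u) for d; 4 m for the roundings of
  \<open>r3\<close>, q, \<open>r5\<close> and \<open>r6\<close>; and the last summand for the error
  of \<open>r2\<close> inherited by r3 / d, with 2 / D below 0.70711. The second-order savings, such
  as 3.87 u w from (1 - v) (1 - k), are used up in \<open>lower_slack\<close>.\<close>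

lemma Ph_r6_lower:
  "1 + sqrt 2 + w + m - (u ^ 2 + 2 * u * (2 * v + v ^ 2))
    - u * (2 * w - 387 / 100 * u * w + m * (\<epsilon> + 54 / 100 * u) + 4 * m * (1 - 968 / 1000 * u)
        + 70711 / 100000 * (1 - 2 * u) * (w + w ^ 2))
   \<le> Ph + r6"
proof -
  define x where "x = u * (\<epsilon> + 54 / 100 * u)"
  define a where "a = 70711 / 100000 * (k * (w + w ^ 2))"
  have w2: "0 \<le> w ^ 2" "w ^ 2 \<le> w" using w mult_left_mono[of w 1 w] by (auto simp: power2_eq_square)
  have "x = u * \<epsilon> + 54 / 100 * u ^ 2" by (simp add: x_def algebra_simps power2_eq_square)
  moreover have "0 < u * \<epsilon>" using u \<epsilon>_bounds by simp
  ultimately have x: "0 \<le> x" "x \<le> 7 / 100"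
    using \<epsilon>_bounds(3) u small_power_bounds(1,2)[of u] by (simp, linarith)
  have kw: "0 \<le> k * (w + w ^ 2)" "k * (w + w ^ 2) \<le> 1/32 * (w + w ^ 2)"
    by (intro mult_nonneg_nonneg mult_right_mono; use k_bounds w in simp)+
  have "a \<le> m" using kw m_bounds w w2 unfolding a_def distrib_left by linarith
  then have a: "0 \<le> a" "a \<le> m" using kw by (simp_all add: a_def)
  have "2 / D \<le> 70711 / 100000" using D_pos by (simp add: field_simps)
  then have "k * (w + w ^ 2) * (2 / D) \<le> k * (w + w ^ 2) * (70711 / 100000)"
    using kw by (intro mult_left_mono)
  then have "m - a \<le> m - 2 * k * (w + w ^ 2) / D" by (simp add: a_def)
  also have "\<dots> = (2 * w + w ^ 2 - 2 * k * (w + w ^ 2)) / D"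
    unfolding m_D[symmetric] using D_pos by (simp add: diff_divide_distrib)
  finally have ma: "m - a \<le> (2 * w + w ^ 2 - 2 * k * (w + w ^ 2)) / D" .
  have "1 - x \<le> 1 / (1 + x)" using x by (simp add: field_simps)
  then have "(m - a) * (1 - x) \<le> (2 * w + w ^ 2 - 2 * k * (w + w ^ 2)) / D * (1 / (1 + x))"
    using ma a x by (intro mult_mono) auto
  then have "(1 - v) * ((m - a) * (1 - x)) \<le> (1 - v) * ((2 * w + w ^ 2 - 2 * k * (w + w ^ 2)) / D * (1 / (1 + x)))"
    using v_bounds by (intro mult_left_mono) auto
  also have "\<dots> = r3lo / (D * (1 + x))" by (simp add: r3lo_def)
  also have "\<dots> \<le> r3 / d" using r3_over_d_bounds(1) by (simp add: x_def)
  finally have "(1 - v) * ((1 - v) * ((m - a) * (1 - x))) \<le> (1 - v) * (r3 / d)"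
    using v_bounds by (intro mult_left_mono) auto
  then have "(1 - v) * ((1 - v) * ((m - a) * (1 - x))) \<le> q" using q_bounds by linarith
  then have "(1 - v) ^ 2 * ((1 - v) * ((1 - v) * ((m - a) * (1 - x)))) \<le> (1 - v) ^ 2 * q"
    by (intro mult_left_mono) auto
  then have q1: "(1 - v) ^ 4 * (1 - x) * (m - a) \<le> (1 - v) ^ 2 * q"
    by (simp add: eval_nat_numeral algebra_simps)
  have "1 - 4 * v \<le> (1 - v) ^ 4" using Bernoulli_inequality[of "- v" 4] v_bounds by simp
  then have "(1 - 4 * v) * (1 - x) \<le> (1 - v) ^ 4 * (1 - x)" using x by (intro mult_right_mono) auto
  moreover have "0 \<le> v * x" using v_bounds x by simp
  ultimately have "1 - 4 * v - x \<le> (1 - v) ^ 4 * (1 - x)" by (simp add: algebra_simps)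
  then have "(1 - 4 * v - x) * (m - a) \<le> (1 - v) ^ 4 * (1 - x) * (m - a)"
    using a by (intro mult_right_mono) auto
  moreover have "0 \<le> (4 * v + x) * a" using v_bounds x a by (intro mult_nonneg_nonneg) auto
  ultimately have q2: "m - a - m * (4 * v + x) \<le> (1 - v) ^ 2 * q"
    using q1 by (simp add: algebra_simps)
  have "m * v \<le> m * (u * (1 - 968 / 1000 * u))" using m_bounds v_bounds by (intro mult_left_mono) auto
  then have q3: "m - a - m * x - u * (4 * m * (1 - 968 / 1000 * u)) \<le> (1 - v) ^ 2 * q"
    using q2 by (simp add: algebra_simps)
  have "u ^ 3 \<le> u ^ 2 / 32" "u ^ 2 \<le> u / 32" "0 \<le> u ^ 2" using small_power_bounds[of u] u by auto
  moreover have "(1 - 2 * u + 387 / 100 * u ^ 2) * (1 + u) = 1 - u + 187 / 100 * u ^ 2 + 387 / 100 * u ^ 3"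
    "1 - (u - 2 * u ^ 2) = 1 - u + 2 * u ^ 2"
    by (simp_all add: field_simps eval_nat_numeral)
  ultimately have "(1 - 2 * u + 387 / 100 * u ^ 2) * (1 + u) \<le> 1 - k" unfolding k_def by linarith
  then have "1 - 2 * u + 387 / 100 * u ^ 2 \<le> (1 - v) * (1 - k)"
    unfolding v_bounds(5) using u by (simp add: pos_le_divide_eq)
  then have "(1 - 2 * u + 387 / 100 * u ^ 2) * w \<le> (1 - v) * (1 - k) * w" using w by (intro mult_right_mono)
  also have "\<dots> = (1 - v) * (w * (1 - k))" by simp
  also have "\<dots> \<le> (1 - v) * r2" using r2_bounds v_bounds by (intro mult_left_mono) auto
  finally have r2': "w - 2 * u * w + 387 / 100 * u ^ 2 * w \<le> (1 - v) * r2" by (simp add: algebra_simps)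
  have "u * (2 * w - 387 / 100 * u * w + m * (\<epsilon> + 54 / 100 * u) + 4 * m * (1 - 968 / 1000 * u)
        + 70711 / 100000 * (1 - 2 * u) * (w + w ^ 2))
     = 2 * u * w - 387 / 100 * u ^ 2 * w + m * x + u * (4 * m * (1 - 968 / 1000 * u)) + a"
    by (simp add: x_def a_def k_def field_simps power2_eq_square)
  then show ?thesis using q3 r2' r6_bounds(1) Ph by linarith
qed

text \<open>The same first-order budget. Second-order terms are collected generously in 26 u w,
  which the factor 1 + 2 u of the upper inequality can afford.\<close>

lemma Ph_r6_upper:
  "Ph + r6 \<le> 1 + sqrt 2 + w + m + (5 * u ^ 2 + 2 * u ^ 3)
    + u * (2 * w + 4 * m + m * \<epsilon> + 70711 / 100000 * (w + w ^ 2) + 26 * u * w)"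
proof -
  define x where "x = u * \<epsilon>"
  define a where "a = 70711 / 100000 * (w + w ^ 2)"
  \<comment> \<open>D M dominates the unrounded 2 r2 + r2^2, as 2 / D <= 0.70711 and 1 / D <=
    0.36.\<close>
  define M where "M = m + u * a + 36 / 100 * u ^ 2 * w ^ 2"
  have w2: "0 \<le> w ^ 2" "w ^ 2 \<le> w" using w mult_left_mono[of w 1 w] by (auto simp: power2_eq_square)
  have u2: "0 \<le> u ^ 2" using u by simp
  have p: "u ^ 2 \<le> u / 32" "u ^ 3 \<le> u ^ 2 / 32" "u ^ 4 \<le> u ^ 3 / 32"
    using small_power_bounds[of u] u by auto
  have x: "0 \<le> x" "x \<le> 6 / 100" using \<epsilon>_bounds u by (auto simp: x_def)
  have M: "0 \<le> M" using m_bounds u w by (auto simp: M_def a_def)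
  have "k * (w + w ^ 2) \<le> u * (w + w ^ 2)" "k ^ 2 \<le> u ^ 2"
    using k_bounds w by (auto intro!: mult_right_mono power_mono)
  moreover from this(2) have "k ^ 2 * w ^ 2 \<le> u ^ 2 * w ^ 2" using w2 by (intro mult_right_mono) auto
  ultimately have "2 * w + w ^ 2 + 2 * k * (w + w ^ 2) + k ^ 2 * w ^ 2
      \<le> m * D + 2 * (u * (w + w ^ 2)) + u ^ 2 * w ^ 2" unfolding m_D by simp
  also have "\<dots> \<le> D * M"
  proof -
    have "2 * (u * (w + w ^ 2)) \<le> D * 70711 / 100000 * (u * (w + w ^ 2))"
      using D_pos u w by (intro mult_right_mono) auto
    moreover have "1 * (u ^ 2 * w ^ 2) \<le> D * 36 / 100 * (u ^ 2 * w ^ 2)"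
      using D_pos by (intro mult_right_mono) auto
    ultimately show ?thesis by (simp add: M_def a_def field_simps)
  qed
  finally have "(1 + v) * (2 * w + w ^ 2 + 2 * k * (w + w ^ 2) + k ^ 2 * w ^ 2) \<le> (1 + u) * (D * M)"
    using v_bounds u k_bounds w by (intro mult_mono) auto
  then have "r3hi / (D * (1 - x)) \<le> ((1 + u) * (D * M)) / (D * (1 - x))"
    unfolding r3hi_def using D_pos x by (intro divide_right_mono) auto
  also have "\<dots> = (1 + u) * M * (1 / (1 - x))" using D_pos x by (simp add: field_simps)
  also have "\<dots> \<le> (1 + u) * M * (1 + x + 36 / 10 * u ^ 2)"
  proof (intro mult_left_mono)
    have "\<epsilon> ^ 2 \<le> (18243 / 10000) ^ 2" using \<epsilon>_bounds by (intro power_mono) auto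
    then have "\<epsilon> ^ 2 \<le> 333 / 100" by (simp add: power_divide)
    then have "u ^ 2 * (\<epsilon> ^ 2 + 36 / 10 * x) \<le> u ^ 2 * (36 / 10)" using x u2 by (intro mult_left_mono) auto
    moreover have "(1 + x + 36 / 10 * u ^ 2) * (1 - x) = 1 + u ^ 2 * 36 / 10 - u ^ 2 * (\<epsilon> ^ 2 + 36 / 10 * x)"
      by (simp add: x_def field_simps power2_eq_square)
    ultimately have "1 \<le> (1 + x + 36 / 10 * u ^ 2) * (1 - x)" by linarith
    then show "1 / (1 - x) \<le> 1 + x + 36 / 10 * u ^ 2" using x by (simp add: pos_divide_le_eq)
  qed (use M u in auto)
  finally have "r3 / d \<le> (1 + u) * M * (1 + x + 36 / 10 * u ^ 2)"
    using r3_over_d_bounds(2) unfolding x_def by linarith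
  moreover have r0: "0 \<le> r3 / d" using r3_over_d_bounds(3) r3_bounds by simp
  ultimately have "(1 + v) * (r3 / d) \<le> (1 + u) * ((1 + u) * M * (1 + x + 36 / 10 * u ^ 2))"
    using v_bounds u by (intro mult_mono) auto
  then have "q \<le> (1 + u) * ((1 + u) * M * (1 + x + 36 / 10 * u ^ 2))" using q_bounds by linarith
  moreover have "(1 + v) ^ 2 \<le> (1 + u) ^ 2" using v_bounds by (intro power_mono) auto
  ultimately have "(1 + v) ^ 2 * q \<le> (1 + u) ^ 2 * ((1 + u) * ((1 + u) * M * (1 + x + 36 / 10 * u ^ 2)))"
    using q_bounds by (intro mult_mono) auto
  also have "\<dots> = (1 + u) ^ 4 * (1 + x + 36 / 10 * u ^ 2) * M" by (simp add: eval_nat_numeral field_simps)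
  also have "\<dots> \<le> (1 + (4 + \<epsilon>) * u + 18 * u ^ 2) * M"
  proof (intro mult_right_mono M)
    have "(1 + u) ^ 4 = 1 + 4 * u + 6 * u ^ 2 + 4 * u ^ 3 + u ^ 4"
      by (simp add: eval_nat_numeral algebra_simps)
    then have "(1 + u) ^ 4 \<le> 1 + 4 * u + 62 / 10 * u ^ 2" using p u2 by linarith
    then have "(1 + u) ^ 4 * (1 + x + 36 / 10 * u ^ 2) \<le> (1 + 4 * u + 62 / 10 * u ^ 2) * (1 + x + 36 / 10 * u ^ 2)"
      using x u2 by (intro mult_right_mono) auto
    also have "\<dots> = 1 + 4 * u + \<epsilon> * u + 98 / 10 * u ^ 2 + 4 * (u ^ 2 * \<epsilon>) + 62 / 10 * (u ^ 2 * x) + 144 / 10 * u ^ 3 + 2232 / 100 * u ^ 4"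
      by (simp add: x_def field_simps eval_nat_numeral)
    also have "\<dots> \<le> 1 + 4 * u + \<epsilon> * u + 18 * u ^ 2"
    proof -
      have "u ^ 2 * \<epsilon> \<le> u ^ 2 * (18243 / 10000)" "u ^ 2 * x \<le> u ^ 2 * (6 / 100)"
        by (intro mult_left_mono; use x u2 \<epsilon>_bounds in simp)+
      then show ?thesis using p u2 by linarith
    qed
    finally show "(1 + u) ^ 4 * (1 + x + 36 / 10 * u ^ 2) \<le> 1 + (4 + \<epsilon>) * u + 18 * u ^ 2"
      by (simp add: algebra_simps)
  qed
  also have "\<dots> \<le> m + u * (4 * m + m * \<epsilon> + a) + 25 * (u ^ 2 * w)"
  proof -
    have eu: "(4 + \<epsilon>) * u \<le> (58243 / 10000) * u" using \<epsilon>_bounds u by (intro mult_right_mono) auto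
    have F: "1 + (4 + \<epsilon>) * u + 18 * u ^ 2 \<le> 1 + 64 / 10 * u"
      using eu p u by linarith
    have a: "0 \<le> a" "a \<le> 141422 / 100000 * w" using w w2 unfolding a_def distrib_left by linarith+
    have "(1 + (4 + \<epsilon>) * u + 18 * u ^ 2) * (u * a + 36 / 100 * u ^ 2 * w ^ 2)
        \<le> (1 + 64 / 10 * u) * (u * a + 36 / 100 * u ^ 2 * w ^ 2)"
      using F a u by (intro mult_right_mono) auto
    also have "\<dots> = u * a + 64 / 10 * (u ^ 2 * a) + (36 / 100 + 2304 / 1000 * u) * (u ^ 2 * w ^ 2)"
      by (simp add: field_simps power2_eq_square)
    also have "\<dots> \<le> u * a + 64 / 10 * (u ^ 2 * (141422 / 100000 * w)) + 44 / 100 * (u ^ 2 * w)"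
      using a u u2 w2 by (intro add_mono mult_left_mono mult_mono) auto
    moreover have "18 * u ^ 2 * m \<le> 18 * u ^ 2 * (822 / 1000 * w)"
      using m_bounds u2 by (intro mult_left_mono) auto
    moreover have "0 \<le> u ^ 2 * w" using w by simp
    ultimately show ?thesis by (simp add: M_def algebra_simps)
  qed
  finally have q': "(1 + v) ^ 2 * q \<le> m + u * (4 * m + m * \<epsilon> + a) + 25 * (u ^ 2 * w)" .
  have "(1 + v) * r2 \<le> (1 + u) * (w * (1 + u))"
    using v_bounds r2_bounds k_bounds w u by (intro mult_mono order_trans[OF r2_bounds(2)] mult_left_mono) auto
  also have "\<dots> = w + 2 * (u * w) + u ^ 2 * w" by (simp add: algebra_simps power2_eq_square)
  finally have r2': "(1 + v) * r2 \<le> w + 2 * (u * w) + u ^ 2 * w" .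
  have "2 * v + v ^ 2 \<le> 2 * u + u ^ 2" using v_bounds by (intro add_mono power_mono) auto
  then have "2 * u * (2 * v + v ^ 2) \<le> 2 * u * (2 * u + u ^ 2)" using u by (intro mult_left_mono) auto
  also have "\<dots> = 4 * u ^ 2 + 2 * u ^ 3" by (simp add: algebra_simps eval_nat_numeral)
  finally have v': "2 * u * (2 * v + v ^ 2) \<le> 4 * u ^ 2 + 2 * u ^ 3" .
  have "u * (2 * w + 4 * m + m * \<epsilon> + 70711 / 100000 * (w + w ^ 2) + 26 * u * w)
      = 2 * (u * w) + u ^ 2 * w + u * (4 * m + m * \<epsilon> + a) + 25 * (u ^ 2 * w)"
    by (simp add: a_def field_simps power2_eq_square)
  then show ?thesis using q' r2' v' r6_bounds(2) Ph by linarith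
qed


section \<open>The two inequalities on z in the branch near x = y\<close>

definition "z0 = 1 + sqrt 2 + w + m"
definition "g = (sqrt 2 + m) * z0 / (2 + sqrt 2)"
text \<open>Excess of \<open>m\<close> over its tangent at \<open>w = 0\<close>. The final inequalities have a slack of only
  about \<open>0.03 * u * w\<close> to first order in \<open>w\<close>, and are nearly independent of \<open>t\<close>.\<close>
definition "t = m - 7071 / 10000 * w"

lemma t_bounds: "0 \<le> t" "t \<le> 1149 / 10000 * w" "t \<le> 1 / 100000 * w + 17678 / 100000 * w ^ 2"
  using m_bounds unfolding t_def by linarith+

lemma w2_bounds: "0 \<le> w ^ 2" "w ^ 2 \<le> w" "0 \<le> w ^ 3" "w ^ 3 \<le> w ^ 2"
proof -
  have "w ^ 2 * w \<le> w ^ 2 * 1" using w by (intro mult_left_mono) auto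
  then show "w ^ 3 \<le> w ^ 2" by (simp add: eval_nat_numeral)
qed (use w mult_left_mono[of w 1 w] in \<open>auto simp: power2_eq_square\<close>)

lemma g_minus_1: "(2 + sqrt 2) * (g - 1) = sqrt 2 * (w + m) + m * z0"
proof -
  have s: "sqrt 2 * (sqrt 2 * a) = 2 * a" for a by (simp flip: mult.assoc)
  have "(2 + sqrt 2) * g = (sqrt 2 + m) * z0" by (simp add: g_def add_nonneg_eq_0_iff)
  then show ?thesis by (simp add: z0_def algebra_simps s)
qed

text \<open>The expansion of g - 1 in w and t, with coefficients rounded down and the nonnegative
  terms in w t and t^2 dropped.\<close>

definition "G1 = 12070 / 10000 * w + 11213 / 10000 * t + 3535 / 10000 * w ^ 2"

lemma g_bounds: "G1 \<le> g - 1" "0 \<le> G1" "G1 \<le> 17 / 10 * w" "g - 1 \<le> 1775 / 1000 * w" "1 \<le> g"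
proof -
  have wt: "0 \<le> w * t" "0 \<le> t ^ 2" using w t_bounds by auto
  have s: "1414213 / 1000000 * w \<le> sqrt 2 * w" "1414213 / 1000000 * t \<le> sqrt 2 * t" "sqrt 2 * w \<le> 1414214 / 1000000 * w"
    "1414213 / 1000000 * w ^ 2 \<le> sqrt 2 * w ^ 2"
    by (intro mult_right_mono; use sqrt2_bounds w t_bounds in simp)+
  have m: "m = 7071 / 10000 * w + t" by (simp add: t_def)
  show G1: "0 \<le> G1" "G1 \<le> 17 / 10 * w"
    using t_bounds w2_bounds w unfolding G1_def by linarith+
  have "(2 + sqrt 2) * (g - 1) = 17071 / 10000 * (sqrt 2 * w) + sqrt 2 * t + 7071 / 10000 * w + 7071 / 10000 * (sqrt 2 * w) + t + sqrt 2 * t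
     + 120709041 / 100000000 * w ^ 2 + 24142 / 10000 * (w * t) + t ^ 2"
    unfolding g_minus_1 z0_def m by (simp add: field_simps power2_eq_square)
  then have "3414214 / 1000000 * G1 \<le> (2 + sqrt 2) * (g - 1)"
    unfolding G1_def distrib_left using s wt t_bounds w2_bounds w by linarith
  moreover have "(2 + sqrt 2) * G1 \<le> 3414214 / 1000000 * G1" using sqrt2_bounds G1 by (intro mult_right_mono) auto
  ultimately have "(2 + sqrt 2) * G1 \<le> (2 + sqrt 2) * (g - 1)" by linarith
  then show *: "G1 \<le> g - 1" by (rule mult_left_le_imp_le) (auto simp: add_pos_pos)
  then show "1 \<le> g" using G1 by linarith
  have "m * m \<le> (822 / 1000 * w) * (822 / 1000 * w)" using m_bounds w by (intro mult_mono) auto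
  then have mm: "m * m \<le> 675684 / 1000000 * w ^ 2" by (simp add: power2_eq_square)
  have "w * m \<le> w * (822 / 1000 * w)" using m_bounds w by (intro mult_left_mono) auto
  then have wm: "w * m \<le> 822 / 1000 * w ^ 2" by (simp add: power2_eq_square)
  have "sqrt 2 * m \<le> sqrt 2 * (822 / 1000 * w)" using m_bounds by (intro mult_left_mono) auto
  then have sm: "sqrt 2 * m \<le> 822 / 1000 * (sqrt 2 * w)" by simp
  have "(2 + sqrt 2) * (g - 1) = sqrt 2 * w + 2 * (sqrt 2 * m) + m + w * m + m * m"
    unfolding g_minus_1 z0_def by (simp add: algebra_simps)
  also have "\<dots> \<le> 2644 / 1000 * (sqrt 2 * w) + 822 / 1000 * w + 1497684 / 1000000 * w ^ 2"
    using m_bounds(2) mm wm sm by linarith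
  also have "\<dots> \<le> 355 / 100 * w + 1775 / 1000 * (sqrt 2 * w)" using s w2_bounds w by linarith
  also have "\<dots> = (2 + sqrt 2) * (1775 / 1000 * w)" by (simp add: field_simps)
  finally show "g - 1 \<le> 1775 / 1000 * w" by (rule mult_left_le_imp_le) (auto simp: add_pos_pos)
qed

definition "X = quot_error u"

lemma X_bounds: "u * (2 * sqrt 2 - 1 + 158 / 100 * u) \<le> X" "u * (1828426 / 1000000 + 158 / 100 * u) \<le> X" "X \<le> 1885 / 1000 * u" "0 < X" "u \<le> X"
proof -
  show a: "u * (2 * sqrt 2 - 1 + 158 / 100 * u) \<le> X"
    using quot_error_bounds(1)[OF u] by (simp add: X_def field_simps power2_eq_square)
  have "u * (1828426 / 1000000 + 158 / 100 * u) \<le> u * (2 * sqrt 2 - 1 + 158 / 100 * u)"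
    using sqrt2_bounds u by (intro mult_left_mono) auto
  then show b: "u * (1828426 / 1000000 + 158 / 100 * u) \<le> X" using a by linarith
  have "u * 1 \<le> u * (1828426 / 1000000 + 158 / 100 * u)" using u by (intro mult_left_mono) auto
  then show "u \<le> X" using b by linarith
  then show "0 < X" using u by linarith
  show "X \<le> 1885 / 1000 * u" using quot_error_bounds(2)[OF u] by (simp add: X_def)
qed

lemma uwt_bounds:
  "0 \<le> w * t" "w * t \<le> w * (1149 / 10000 * w)" "0 \<le> u * w" "0 \<le> u * t" "0 \<le> u * w ^ 2" "0 \<le> u * w ^ 3"
  "u * w ^ 2 \<le> 1/32 * w ^ 2" "u * w ^ 3 \<le> 1/32 * w ^ 3"
proof -
  show "w * t \<le> w * (1149 / 10000 * w)" using w(1) t_bounds(2) by (rule mult_left_mono[rotated])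
  show "u * w ^ 2 \<le> 1/32 * w ^ 2" using u(2) w2_bounds(1) by (rule mult_right_mono)
  show "u * w ^ 3 \<le> 1/32 * w ^ 3" using u(2) w2_bounds(3) by (rule mult_right_mono)
qed (use u w t_bounds in auto)

definition "KL = 2 * w - 387 / 100 * u * w + m * (\<epsilon> + 54 / 100 * u) + 4 * m * (1 - 968 / 1000 * u)
        + 70711 / 100000 * (1 - 2 * u) * (w + w ^ 2)"

text \<open>What remains of the lower inequality once the equality at w = 0 is subtracted: the
  w-dependent loss on the left, the gain from larger z0 and g on the right. Divided by u, it is
  checked monomial by monomial: 6.7124 against 6.7421 for w, 5.6643 against 5.778 for t, 12.654 -
  7.6 against 6.11 - 0.42 for u w. The term 2.62 w^2 is the reserve for a doubled last rounding
  error.\<close>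

lemma lower_slack:
  "u * (KL + 262 / 100 * w ^ 2) * (1 + X * g) \<le> (w + m) * (X - k) + (z0 - z_error u) * X * (g - 1)"
proof -
  define C where "C = KL + 262 / 100 * w ^ 2"
  note wt = uwt_bounds
  have C: "C = 671233653 / 100000000 * w + 56643 / 10000 * t + 3440246 / 1000000 * w ^ 2 + 16 / 100 * (w * t)
      - u * w * 76402772 / 10000000 - 3332 / 1000 * (u * t) - 141422 / 100000 * (u * w ^ 2)"
    unfolding C_def KL_def \<epsilon>_def t_def by (simp add: field_simps power2_eq_square)
  have C1: "C \<le> 67124 / 10000 * w + 56643 / 10000 * t + 346 / 100 * w ^ 2 - 76 / 10 * (u * w)"
    unfolding C using wt w by (simp add: power2_eq_square)
  have C2: "C \<le> 67125 / 10000 * w + 4462 / 1000 * w ^ 2" using C1 t_bounds wt by simp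
  have Xg: "0 \<le> X * g" "X * g \<le> 1885 / 1000 * u * (1 + 1775 / 1000 * w)"
  proof -
    have "g \<le> 1 + 1775 / 1000 * w" using g_bounds(4) by linarith
    then show "X * g \<le> 1885 / 1000 * u * (1 + 1775 / 1000 * w)"
      using X_bounds g_bounds u by (intro mult_mono) auto
  qed (use X_bounds g_bounds in auto)
  have "C * (X * g) \<le> (67125 / 10000 * w + 4462 / 1000 * w ^ 2) * (1885 / 1000 * u * (1 + 1775 / 1000 * w))"
    by (rule mult_mono[OF C2 Xg(2)]) (use Xg w w2_bounds in auto)
  also have "\<dots> \<le> 12654 / 1000 * (u * w) + 30871 / 1000 * (u * w ^ 2) + 1493 / 100 * (u * w ^ 3)"
    using wt by (simp add: field_simps eval_nat_numeral)
  finally have CX: "C * (X * g) \<le> 12654 / 1000 * (u * w) + 30871 / 1000 * (u * w ^ 2) + 1493 / 100 * (u * w ^ 3)" .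
  have m: "w + m = 17071 / 10000 * w + t" by (simp add: t_def)
  have "u * (828426 / 1000000 + 358 / 100 * u) \<le> X - k"
    using X_bounds(2) by (simp add: k_def field_simps power2_eq_square)
  then have "(17071 / 10000 * w + t) * (u * (828426 / 1000000 + 358 / 100 * u)) \<le> (w + m) * (X - k)"
    unfolding m using w t_bounds by (intro mult_left_mono) auto
  moreover have "u * (14142 / 10000 * w + 8284 / 10000 * t + 611 / 100 * (u * w)) \<le> u * ((17071 / 10000 * w + t) * (828426 / 1000000 + 358 / 100 * u))"
    using u w t_bounds wt by (intro mult_left_mono) (auto simp: field_simps)
  ultimately have L1: "u * (14142 / 10000 * w + 8284 / 10000 * t + 611 / 100 * (u * w)) \<le> (w + m) * (X - k)"
    by (simp add: algebra_simps)
  have Z: "2414213 / 1000000 + 17071 / 10000 * w - 216 / 100 * u \<le> z0 - z_error u"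
    using z_error_bounds(3)[OF u] sqrt2_bounds t_bounds unfolding z0_def t_def by linarith
  have u2: "u ^ 2 \<le> u / 32" using small_power_bounds(2)[of u] u by simp
  have ZX: "(2414213 / 1000000 + 17071 / 10000 * w - 216 / 100 * u) * (1828426 / 1000000 + 158 / 100 * u) = 4414209818738 / 1000000000000 + 31213060246 / 10000000000 * w - 13494362 / 100000000 * u
      + 2697218 / 1000000 * (u * w) - 34128 / 10000 * u ^ 2" by (simp add: field_simps power2_eq_square)
  have "44142 / 10000 + 31213 / 10000 * w - 242 / 1000 * u \<le> (2414213 / 1000000 + 17071 / 10000 * w - 216 / 100 * u) * (1828426 / 1000000 + 158 / 100 * u)"
    unfolding ZX using wt u2 w u by linarith
  then have "u * (44142 / 10000 + 31213 / 10000 * w - 242 / 1000 * u) \<le> (2414213 / 1000000 + 17071 / 10000 * w - 216 / 100 * u) * (u * (1828426 / 1000000 + 158 / 100 * u))"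
    using u mult_left_mono[of "44142 / 10000 + 31213 / 10000 * w - 242 / 1000 * u" "(2414213 / 1000000 + 17071 / 10000 * w - 216 / 100 * u) * (1828426 / 1000000 + 158 / 100 * u)" u]
    by (simp add: algebra_simps)
  also have "\<dots> \<le> (z0 - z_error u) * X"
    using Z X_bounds(2) u w by (intro mult_mono) auto
  finally have "u * (44142 / 10000 + 31213 / 10000 * w - 242 / 1000 * u) \<le> (z0 - z_error u) * X" .
  moreover have zE: "0 \<le> z0 - z_error u" using Z u w by linarith
  ultimately have "u * (44142 / 10000 + 31213 / 10000 * w - 242 / 1000 * u) * G1 \<le> (z0 - z_error u) * X * (g - 1)"
    using g_bounds(1,2) X_bounds(4) zE by (intro mult_mono[OF _ g_bounds(1)]) auto
  moreover have "u * (53279 / 10000 * w + 49496 / 10000 * t + 53278 / 10000 * w ^ 2 + 1103 / 1000 * w ^ 3 - 42 / 100 * (u * w))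
      \<le> u * ((44142 / 10000 + 31213 / 10000 * w - 242 / 1000 * u) * G1)"
  proof (intro mult_left_mono)
    have "u * G1 \<le> u * (17 / 10 * w)" using u g_bounds by (intro mult_left_mono) auto
    moreover have "(44142 / 10000 + 31213 / 10000 * w) * G1 = 53279394 / 10000000 * w + 494964246 / 100000000 * t + 53278288 / 10000000 * w ^ 2
        + 349991369 / 100000000 * (w * t) + 110337955 / 100000000 * w ^ 3"
      by (simp add: G1_def field_simps eval_nat_numeral)
    moreover have "(44142 / 10000 + 31213 / 10000 * w - 242 / 1000 * u) * G1 = (44142 / 10000 + 31213 / 10000 * w) * G1 - 242 / 1000 * (u * G1)"
      by (simp add: algebra_simps)
    ultimately show "53279 / 10000 * w + 49496 / 10000 * t + 53278 / 10000 * w ^ 2 + 1103 / 1000 * w ^ 3 - 42 / 100 * (u * w)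
      \<le> (44142 / 10000 + 31213 / 10000 * w - 242 / 1000 * u) * G1"
      using wt w w2_bounds t_bounds by linarith
  qed (use u in auto)
  ultimately have L2: "u * (53279 / 10000 * w + 49496 / 10000 * t + 53278 / 10000 * w ^ 2 + 1103 / 1000 * w ^ 3 - 42 / 100 * (u * w))
      \<le> (z0 - z_error u) * X * (g - 1)" by (simp add: mult.assoc)
  have "C + C * (X * g) \<le> (14142 / 10000 * w + 8284 / 10000 * t + 611 / 100 * (u * w))
      + (53279 / 10000 * w + 49496 / 10000 * t + 53278 / 10000 * w ^ 2 + 1103 / 1000 * w ^ 3 - 42 / 100 * (u * w))"
    using C1 CX wt w w2_bounds t_bounds by linarith
  then have "u * (C + C * (X * g)) \<le> u * ((14142 / 10000 * w + 8284 / 10000 * t + 611 / 100 * (u * w))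
      + (53279 / 10000 * w + 49496 / 10000 * t + 53278 / 10000 * w ^ 2 + 1103 / 1000 * w ^ 3 - 42 / 100 * (u * w)))"
    using u by (intro mult_left_mono) auto
  also have "\<dots> \<le> (w + m) * (X - k) + (z0 - z_error u) * X * (g - 1)"
    using add_mono[OF L1 L2] by (simp only: distrib_left)
  finally show ?thesis unfolding C_def[symmetric] by (simp add: algebra_simps)
qed

lemma z_lower:
  assumes "Ph + r6 - 2 * u - 262 / 100 * u * w ^ 2 \<le> z"
  shows "z0 * (1 + k) \<le> z * (1 + X * g)"
proof -
  define E where "E = z_error u"
  have vE: "E = (2 * u + u ^ 2) * (1 + v) ^ 2"
  proof -
    have "1 + v = (1 + 2 * u) / (1 + u)" using u by (simp add: v_def field_simps)
    then show ?thesis by (simp add: E_def z_error_def power_divide algebra_simps power2_eq_square)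
  qed
  have "0 \<le> u ^ 2 * (2 * v + v ^ 2)" using v_bounds by (intro mult_nonneg_nonneg) auto
  then have "u ^ 2 + 2 * u * (2 * v + v ^ 2) + 2 * u \<le> E"
    unfolding vE by (simp add: algebra_simps power2_eq_square)
  then have z: "z0 - E - u * (KL + 262 / 100 * w ^ 2) \<le> z"
    using assms Ph_r6_lower unfolding z0_def KL_def distrib_left by linarith
  have Xg: "0 < X * g" using X_bounds g_bounds by simp
  \<comment> \<open>The definition of X rearranged. It says that the claim is an equality at w = 0,
    z = z0 - E, and it cancels the terms free of w.\<close>
  have EX: "E * (1 + X) = (1 + sqrt 2) * (X - k)"
    using quot_error_eq[OF u] by (simp add: E_def X_def k_def algebra_simps)
  have "(z0 - E - u * (KL + 262 / 100 * w ^ 2)) * (1 + X * g) - z0 * (1 + k)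
    = (z0 - E) * X * (g - 1) + z0 * (X - k) - E * (1 + X) - u * (KL + 262 / 100 * w ^ 2) * (1 + X * g)"
    by (simp add: algebra_simps)
  also have "\<dots> = ((w + m) * (X - k) + (z0 - E) * X * (g - 1)) - u * (KL + 262 / 100 * w ^ 2) * (1 + X * g)"
    unfolding EX by (simp add: z0_def algebra_simps)
  also have "\<dots> \<ge> 0" using lower_slack by (simp add: E_def)
  finally have "z0 * (1 + k) \<le> (z0 - E - u * (KL + 262 / 100 * w ^ 2)) * (1 + X * g)" by simp
  also have "\<dots> \<le> z * (1 + X * g)" using z Xg by (intro mult_right_mono) auto
  finally show ?thesis .
qed

lemma z_upper:
  assumes "z \<le> Ph + r6 + 2 * u + 36 / 10 * u * w ^ 2"
  shows "z \<le> z0 * (1 + X * (1 + 2 * u) * g - k)"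
proof -
  note wt = uwt_bounds
  have uG: "0 \<le> u * G1" using u g_bounds by simp
  define KU where "KU = 2 * w + 4 * m + m * \<epsilon> + 70711 / 100000 * (w + w ^ 2) + 26 * u * w"
  have "KU = 671233653 / 100000000 * w + 56643 / 10000 * t + 820246 / 1000000 * w ^ 2 + 16 / 100 * (w * t) + 26 * (u * w)"
    unfolding KU_def \<epsilon>_def t_def by (simp add: field_simps power2_eq_square)
  then have KU: "KU + 36 / 10 * w ^ 2 \<le> 67124 / 10000 * w + 56643 / 10000 * t + 44390 / 10000 * w ^ 2 + 26 * (u * w)"
    using wt w by (simp add: power2_eq_square)
  define c where "c = 2 * sqrt 2 - 1"
  have c: "1828426 / 1000000 \<le> c" using sqrt2_bounds by (simp add: c_def)
  \<comment> \<open>(1 + sqrt 2) (2 sqrt 2 - 2) = 2: the tolerance at w = 0 matches the 2 u of the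
    last rounding to first order, and the second-order part, 17.45 u against 5 u, decides.\<close>
  have zc: "z0 * (c - 1) = 2 + (w + m) * (c - 1)"
    unfolding z0_def c_def by (simp add: algebra_simps)
  have m: "w + m = 17071 / 10000 * w + t" by (simp add: t_def)
  have z0: "2414213 / 1000000 + 17071 / 10000 * w \<le> z0"
    using sqrt2_bounds t_bounds unfolding z0_def t_def by linarith
  \<comment> \<open>5.23 is 1.58 + 2 c rounded down, with c > 1.828; subtracting k = u - 2 u^2 later
    raises it to 7.23.\<close>
  have "u * (c + 523 / 100 * u) \<le> u * (c + 158 / 100 * u) * (1 + 2 * u)"
  proof -
    have "u * (u * (2 * 1828426 / 1000000)) \<le> u * (u * (2 * c))" using c u by (intro mult_left_mono) auto
    moreover have "0 \<le> u ^ 3" "0 \<le> u * u" using u by simp_all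
    moreover have "u * (c + 523 / 100 * u) = u * c + 523 / 100 * (u * u)"
      "u * (c + 158 / 100 * u) * (1 + 2 * u) = u * c + 158 / 100 * (u * u) + u * (u * (2 * c)) + 316 / 100 * u ^ 3"
      "u * (u * (2 * 1828426 / 1000000)) = 3656852 / 1000000 * (u * u)"
      by (simp_all add: field_simps eval_nat_numeral)
    ultimately show ?thesis by linarith
  qed
  also have "\<dots> \<le> X * (1 + 2 * u)"
    using X_bounds(1) u unfolding c_def by (intro mult_right_mono) auto
  finally have X: "u * (c + 523 / 100 * u) \<le> X * (1 + 2 * u)" .
  have Gg: "1 + G1 \<le> g" using g_bounds by linarith
  have "u * (c + 523 / 100 * u) * (1 + G1) \<le> X * (1 + 2 * u) * g"
    by (rule mult_mono[OF X Gg]) (use u g_bounds X_bounds in auto)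
  moreover have "u * ((c - 1) + 723 / 100 * u + (1828426 / 1000000 + 523 / 100 * u) * G1) \<le> u * (c + 523 / 100 * u) * (1 + G1) - k"
  proof -
    have "u * ((1828426 / 1000000 + 523 / 100 * u) * G1) \<le> u * ((c + 523 / 100 * u) * G1)"
      using c u g_bounds by (intro mult_left_mono mult_right_mono) auto
    then show ?thesis by (simp add: k_def field_simps power2_eq_square)
  qed
  ultimately have "u * ((c - 1) + 723 / 100 * u + (1828426 / 1000000 + 523 / 100 * u) * G1) \<le> X * (1 + 2 * u) * g - k"
    by linarith
  then have "z0 * (u * ((c - 1) + 723 / 100 * u + (1828426 / 1000000 + 523 / 100 * u) * G1)) \<le> z0 * (X * (1 + 2 * u) * g - k)"
    using z0 w by (intro mult_left_mono) auto
  moreover have "2 + 5 * u + 2 * u ^ 2 + KU + 36 / 10 * w ^ 2 \<le> z0 * ((c - 1) + 723 / 100 * u + (1828426 / 1000000 + 523 / 100 * u) * G1)"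
  proof -
    have "(17071 / 10000 * w + t) * (828426 / 1000000) \<le> (w + m) * (c - 1)"
      unfolding m using c w t_bounds by (intro mult_left_mono) auto
    moreover have "(2414213 / 1000000 + 17071 / 10000 * w) * (723 / 100 * u + (1828426 / 1000000 + 523 / 100 * u) * G1)
        \<le> z0 * (723 / 100 * u + (1828426 / 1000000 + 523 / 100 * u) * G1)"
      using z0 u g_bounds by (intro mult_right_mono) auto
    moreover have "1745 / 100 * u + 1234 / 100 * (u * w) + (44142 / 10000 + 31213 / 10000 * w + 1262 / 100 * u) * G1
        \<le> (2414213 / 1000000 + 17071 / 10000 * w) * (723 / 100 * u + (1828426 / 1000000 + 523 / 100 * u) * G1)"
    proof -
      have "0 \<le> w * G1" "0 \<le> u * (w * G1)" using w u g_bounds by auto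
      then show ?thesis using wt uG g_bounds u by (simp add: field_simps)
    qed
    moreover have "53279 / 10000 * w + 49496 / 10000 * t + 53278 / 10000 * w ^ 2 + 1523 / 100 * (u * w)
        \<le> (44142 / 10000 + 31213 / 10000 * w + 1262 / 100 * u) * G1"
    proof -
      have "(44142 / 10000 + 31213 / 10000 * w + 1262 / 100 * u) * G1 = 53279394 / 10000000 * w + 494964246 / 100000000 * t + 53278288 / 10000000 * w ^ 2
        + 349991369 / 100000000 * (w * t) + 110337955 / 100000000 * w ^ 3 + 1523234 / 100000 * (u * w) + 14150806 / 1000000 * (u * t) + 446117 / 100000 * (u * w ^ 2)"
        by (simp add: G1_def field_simps eval_nat_numeral)
      then show ?thesis using wt w w2_bounds t_bounds by linarith
    qed
    moreover have "z0 * ((c - 1) + 723 / 100 * u + (1828426 / 1000000 + 523 / 100 * u) * G1)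
      = 2 + (w + m) * (c - 1) + z0 * (723 / 100 * u + (1828426 / 1000000 + 523 / 100 * u) * G1)"
      unfolding zc[symmetric] by (simp add: algebra_simps)
    moreover have "2 * u ^ 2 \<le> u" using small_power_bounds(2)[of u] u by simp
    ultimately show ?thesis
      using KU wt w w2_bounds t_bounds u unfolding distrib_right by linarith
  qed
  then have "u * (2 + 5 * u + 2 * u ^ 2 + KU + 36 / 10 * w ^ 2)
      \<le> u * (z0 * ((c - 1) + 723 / 100 * u + (1828426 / 1000000 + 523 / 100 * u) * G1))"
    using u by (intro mult_left_mono) auto
  moreover have "Ph + r6 + 2 * u + 36 / 10 * u * w ^ 2 \<le> z0 + u * (2 + 5 * u + 2 * u ^ 2 + KU + 36 / 10 * w ^ 2)"
    using Ph_r6_upper unfolding z0_def KU_def by (simp add: field_simps eval_nat_numeral)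
  ultimately show ?thesis using assms by (simp add: algebra_simps)
qed


lemma sqrt_eq: "sqrt (1 + (1 + w) ^ 2) = sqrt 2 + m"
  by (simp add: m_def hyp_gap_def)

lemma m_le_of_w_le_three_quarters:
  assumes "w \<le> 3/4"
  shows "sqrt 2 + m \<le> 20157 / 10000"
proof -
  have "(1 + w) ^ 2 \<le> (1 + 3/4) ^ 2" using assms w by (intro power_mono) auto
  then have F: "1 + (1 + w) ^ 2 \<le> (20157 / 10000) ^ 2" by (simp add: power_divide)
  show ?thesis unfolding sqrt_eq[symmetric] by (rule real_le_lsqrt[OF _ F]) simp
qed

lemma Ph_r6_range:
  "0 \<le> Ph + r6" "Ph + r6 \<le> 8" "w \<le> 3/4 \<Longrightarrow> Ph + r6 \<le> 4"
proof -
  have p: "u ^ 2 \<le> u / 32" "u ^ 3 \<le> u ^ 2 / 32" "0 \<le> u ^ 2" "0 \<le> u ^ 3"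
    using small_power_bounds[of u] u by auto
  have "v ^ 2 \<le> u ^ 2" "v \<le> u" using v_bounds by (auto intro: power_mono)
  then have "2 * v + v ^ 2 \<le> 3" using p u by linarith
  then have "2 * u * (2 * v + v ^ 2) \<le> 2 * u * 3" using u by (intro mult_left_mono) auto
  moreover have "0 \<le> (1 - v) ^ 2 * q" "0 \<le> (1 - v) * r2"
    using v_bounds q_bounds r2_bounds by auto
  ultimately show "0 \<le> Ph + r6"
    using r6_bounds(1) Ph p u sqrt2_bounds unfolding abs_le_iff by linarith
  have K: "Ph + r6 \<le> 1 + sqrt 2 + w + m + (5 * u ^ 2 + 2 * u ^ 3)
      + 1/32 * (2 * w + 4 * m + m * 18243 / 10000 + 70711 / 100000 * (w + w ^ 2) + 26/32 * w)"
  proof -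
    have "m * \<epsilon> \<le> m * (18243 / 10000)" "u * w \<le> 1/32 * w"
      using mult_left_mono[OF \<epsilon>_bounds(2) m_bounds(4)] mult_right_mono[OF u(2) w(1)] .
    then have "u * (2 * w + 4 * m + m * \<epsilon> + 70711 / 100000 * (w + w ^ 2) + 26 * u * w)
        \<le> 1/32 * (2 * w + 4 * m + m * 18243 / 10000 + 70711 / 100000 * (w + w ^ 2) + 26/32 * w)"
      using u w m_bounds \<epsilon>_bounds by (intro mult_mono) auto
    then show ?thesis using Ph_r6_upper by linarith
  qed
  show "Ph + r6 \<le> 8"
    using K p u w m_bounds w2_bounds sqrt2_bounds unfolding distrib_left by linarith
  show "Ph + r6 \<le> 4" if "w \<le> 3/4"
  proof -
    have "w ^ 2 \<le> (3/4) ^ 2" using that w by (intro power_mono) auto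
    then show ?thesis
      using K p u w m_le_of_w_le_three_quarters[OF that] that sqrt2_bounds
      unfolding distrib_left power_divide by simp
  qed
qed

text \<open>When \<open>Ph + r6\<close> exceeds 4 its rounding error may double to \<open>4 * u\<close>; this only happens for
  large \<open>w\<close>, so the excess is absorbed by a multiple of \<open>u * w\<^sup>2\<close>.\<close>
lemma z_bounds:
  assumes "Ph + r6 \<le> 4 \<Longrightarrow> \<bar>z - (Ph + r6)\<bar> \<le> 2 * u"
    and "\<bar>z - (Ph + r6)\<bar> \<le> 4 * u" and "4 \<le> Ph + r6 \<Longrightarrow> 4 \<le> z"
  shows "z0 * (1 + k) \<le> z * (1 + X * g)" "z \<le> z0 * (1 + X * (1 + 2 * u) * g - k)"
proof -
  have uw: "0 \<le> c * u * w ^ 2" if "0 \<le> c" for c using u that by simp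
  have big: "2 * u \<le> c * u * w ^ 2" if "a \<le> w" "2 \<le> c * a ^ 2" "0 \<le> a" "0 \<le> c" for a c
  proof -
    have "c * a ^ 2 \<le> c * w ^ 2" using that by (intro mult_left_mono power_mono) auto
    then have "u * 2 \<le> u * (c * w ^ 2)" using that u by (intro mult_left_mono) auto
    then show ?thesis by (simp add: algebra_simps)
  qed
  show "z \<le> z0 * (1 + X * (1 + 2 * u) * g - k)"
  proof (cases "Ph + r6 \<le> 4")
    case True
    then show ?thesis using assms(1) uw[of "36 / 10"] unfolding abs_le_iff by (intro z_upper) linarith
  next
    case False
    then have "3/4 \<le> w" using Ph_r6_range(3) by linarith
    \<comment> \<open>3.6 is chosen so that 3.6 (3/4)^2 = 2.025 just exceeds 2.\<close>
    then have "2 * u \<le> 36 / 10 * u * w ^ 2" by (rule big) (simp_all add: power_divide)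
    then show ?thesis using assms(2) unfolding abs_le_iff by (intro z_upper) linarith
  qed
  show "z0 * (1 + k) \<le> z * (1 + X * g)"
  proof (cases "Ph + r6 \<le> 4")
    case True
    then show ?thesis using assms(1) uw[of "262 / 100"] unfolding abs_le_iff by (intro z_lower) linarith
  next
    case F: False
    show ?thesis
    proof (cases "z0 \<le> 4")
      case True
      \<comment> \<open>With z0 <= 4 < Ph + r6, the float 4 separates the two: z >= 4 >= z0, so z is
        not too small at all.\<close>
      have "X * 1 \<le> X * g" using X_bounds g_bounds by (intro mult_left_mono) auto
      then have "k \<le> X * g" using X_bounds k_bounds by linarith
      then show ?thesis using True F assms(3) k_bounds by (intro mult_mono) auto
    next
      case False
      \<comment> \<open>By the Pythagorean triple 8, 15, 17, z0 equals 15/8 + 17/8 = 4 exactly at w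
        = 7/8; and 2.62 (7/8)^2 just exceeds 2.\<close>
      have "7/8 \<le> w"
      proof (rule ccontr)
        assume "\<not> 7/8 \<le> w"
        moreover from this have "(1 + w) ^ 2 \<le> (1 + 7/8) ^ 2" using w by (intro power_mono) auto
        then have F: "1 + (1 + w) ^ 2 \<le> (17/8) ^ 2" by (simp add: power_divide)
        have "sqrt 2 + m \<le> 17/8" unfolding sqrt_eq[symmetric] by (rule real_le_lsqrt[OF _ F]) simp
        ultimately show False using False unfolding z0_def by simp
      qed
      then have "2 * u \<le> 262 / 100 * u * w ^ 2" by (rule big) (simp_all add: power_divide)
      then show ?thesis using assms(2) unfolding abs_le_iff by (intro z_lower) linarith
    qed
  qed
qed

end

section \<open>The branch far from x = y\<close>

lemma far_run:
  fixes r u r' t s z :: real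
  assumes u: "0 < u" "u \<le> 1/32" and "2 \<le> r"
  defines "h \<equiv> sqrt (1 + r ^ 2)" and "k \<equiv> u - 2 * u ^ 2" and "v \<equiv> u / (1 + u)"
  defines "g \<equiv> h * (r + h) / (2 + sqrt 2)"
  assumes r': "\<bar>r' - r\<bar> \<le> v * \<bar>r\<bar>" and t: "\<bar>t - (1 + r' ^ 2)\<bar> \<le> v * \<bar>1 + r' ^ 2\<bar>"
    and s: "\<bar>s - sqrt t\<bar> \<le> v * \<bar>sqrt t\<bar>" and z: "\<bar>z - (r' + s)\<bar> \<le> v * \<bar>r' + s\<bar>"
  shows "1 \<le> g" "(r + h) * (1 + k) \<le> z * (1 + quot_error u * g)"
    "z \<le> (r + h) * (1 + quot_error u * (1 + 2 * u) * g - k)"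
proof -
  define X where "X = quot_error u"
  have p: "u ^ 2 \<le> u / 32" "u ^ 3 \<le> u ^ 2 / 32" "u ^ 4 \<le> u ^ 3 / 32" "0 \<le> u ^ 2" "0 \<le> u ^ 3" "0 \<le> u ^ 4"
    using small_power_bounds[of u] u by auto
  have k: "0 \<le> k" "k \<le> u" using p unfolding k_def by linarith+
  have v: "0 < v" "v < 1" "v \<le> u" "1 - v = 1 / (1 + u)" using u by (auto simp: v_def field_simps)
  have "2 ^ 2 \<le> r ^ 2" using assms(3) by (intro power_mono) auto
  then have "(2236 / 1000) ^ 2 \<le> 1 + r ^ 2" by (simp add: power_divide)
  then have h: "2236 / 1000 \<le> h" "h ^ 2 = 1 + r ^ 2" unfolding h_def by (rule real_le_rsqrt) (simp add: add_nonneg_nonneg)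
  \<comment> \<open>2.236 is just below sqrt 5. From r = 2 on, g exceeds 2.77 and X g reaches 5.06
    u, whereas to first order only 3.5 u for z (three full roundings and one halved by the root)
    plus u for k is needed.\<close>
  have "2236 / 1000 * (2 + 2236 / 1000) \<le> h * (r + h)" using h assms(3) by (intro mult_mono) auto
  moreover have "277 / 100 * (2 + sqrt 2) \<le> 2236 / 1000 * (2 + 2236 / 1000)" using sqrt2_bounds by simp
  ultimately have "277 / 100 * (2 + sqrt 2) \<le> h * (r + h)" by linarith
  then have g: "277 / 100 \<le> g" unfolding g_def by (subst pos_le_divide_eq) (auto simp: add_pos_pos)
  then show "1 \<le> g" by simp
  have "1828426 / 1000000 * u \<le> (2 * sqrt 2 - 1) * u" using sqrt2_bounds u by (intro mult_right_mono) auto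
  then have X: "1828426 / 1000000 * u \<le> X" using quot_error_bounds(1)[OF u] p unfolding X_def by linarith
  have "1828426 / 1000000 * u * (277 / 100) \<le> X * g" by (rule mult_mono[OF X g]) (use X u in auto)
  then have Xg: "506 / 100 * u \<le> X * g" using u by linarith
  have rr: "(1 - v) * r \<le> r'" "r' \<le> (1 + v) * r" "0 \<le> (1 - v) * r"
    using r' assms(3) v by (auto simp: abs_le_iff algebra_simps)
  have r0: "0 \<le> r'" using rr by linarith
  have tt: "(1 - v) * (1 + r' ^ 2) \<le> t" "t \<le> (1 + v) * (1 + r' ^ 2)"
    using t by (auto simp: abs_le_iff algebra_simps)
  have t0: "0 \<le> t" using tt(1) v by (auto intro: order_trans[rotated])
  have ss: "(1 - v) * sqrt t \<le> s" "s \<le> (1 + v) * sqrt t"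
    using s t0 by (auto simp: abs_le_iff algebra_simps)
  have s0: "0 \<le> s" using ss(1) v t0 by (auto intro: order_trans[rotated])
  have zz: "(1 - v) * (r' + s) \<le> z" "z \<le> (1 + v) * (r' + s)"
    using z r0 s0 by (auto simp: abs_le_iff algebra_simps)
  have "((1 - v) * r) ^ 2 \<le> r' ^ 2" using rr by (intro power_mono) auto
  moreover have "(1 - v) ^ 2 \<le> 1 ^ 2" using v by (intro power_mono) auto
  ultimately have "(1 - v) ^ 2 * (1 + r ^ 2) \<le> 1 + r' ^ 2"
    unfolding power_mult_distrib distrib_left by simp
  then have "(1 - v) * ((1 - v) ^ 2 * h ^ 2) \<le> (1 - v) * (1 + r' ^ 2)"
    unfolding h(2) using v by (intro mult_left_mono) auto
  then have t1: "(1 - v) * ((1 - v) ^ 2 * h ^ 2) \<le> t" using tt by linarith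
  have "(1 - u / 2) ^ 2 * (1 + u) = 1 - 3 / 4 * u ^ 2 + u ^ 3 / 4"
    by (simp add: power2_eq_square eval_nat_numeral field_simps)
  then have "(1 - u / 2) ^ 2 * (1 + u) \<le> 1" using p by linarith
  then have "(1 - u / 2) ^ 2 \<le> 1 - v" unfolding v(4) using u by (simp add: pos_le_divide_eq)
  then have "(1 - u / 2) ^ 2 * ((1 - v) ^ 2 * h ^ 2) \<le> (1 - v) * ((1 - v) ^ 2 * h ^ 2)"
    by (intro mult_right_mono) auto
  then have "((1 - u / 2) * ((1 - v) * h)) ^ 2 \<le> t" using t1 by (simp add: power_mult_distrib)
  then have "(1 - u / 2) * ((1 - v) * h) \<le> sqrt t" by (rule real_le_rsqrt)
  then have "(1 - v) * ((1 - u / 2) * ((1 - v) * h)) \<le> (1 - v) * sqrt t" using v by (intro mult_left_mono) auto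
  then have s1: "(1 - v) ^ 2 * (1 - u / 2) * h \<le> s" using ss by (simp add: field_simps power2_eq_square)
  have "(1 - v) * (1 - u / 2) \<le> 1 * 1" using u v by (intro mult_mono) auto
  then have "(1 - v) * (1 - u / 2) * ((1 - v) * r) \<le> 1 * ((1 - v) * r)" using rr by (intro mult_right_mono) auto
  then have "(1 - v) ^ 2 * (1 - u / 2) * r \<le> r'" using rr by (simp add: field_simps power2_eq_square)
  then have "(1 - v) ^ 2 * (1 - u / 2) * (r + h) \<le> r' + s" using s1 unfolding distrib_left by linarith
  then have "(1 - v) * ((1 - v) ^ 2 * (1 - u / 2) * (r + h)) \<le> (1 - v) * (r' + s)"
    using v by (intro mult_left_mono) auto
  then have zlo: "(1 - v) ^ 3 * (1 - u / 2) * (r + h) \<le> z"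
    using zz by (simp add: field_simps eval_nat_numeral)
  have "(1 + u) * (1 + u) ^ 3 \<le> (1 - u / 2) * (1 + 506 / 100 * u)"
  proof -
    have "(1 + u) * (1 + u) ^ 3 = 1 + 4 * u + 6 * u ^ 2 + 4 * u ^ 3 + u ^ 4"
      "(1 - u / 2) * (1 + 506 / 100 * u) = 1 + 456 / 100 * u - 253 / 100 * u ^ 2"
      by (simp_all add: field_simps eval_nat_numeral)
    then show ?thesis using p u by linarith
  qed
  then have "1 + u \<le> (1 - u / 2) * (1 + 506 / 100 * u) / (1 + u) ^ 3"
    using u by (subst pos_le_divide_eq) auto
  also have "\<dots> = (1 - v) ^ 3 * (1 - u / 2) * (1 + 506 / 100 * u)"
    unfolding v(4) power_one_over by simp
  finally have "(r + h) * (1 + u) \<le> (r + h) * ((1 - v) ^ 3 * (1 - u / 2) * (1 + 506 / 100 * u))"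
    using h assms(3) by (intro mult_left_mono) auto
  moreover have "(r + h) * (1 + k) \<le> (r + h) * (1 + u)" using k h assms(3) by (intro mult_left_mono) auto
  moreover have "(1 - v) ^ 3 * (1 - u / 2) * (r + h) * (1 + 506 / 100 * u) \<le> z * (1 + X * g)"
    using zlo Xg u v h assms(3) by (intro mult_mono) (auto intro: order_trans[rotated])
  moreover have "(1 - v) ^ 3 * (1 - u / 2) * (r + h) * (1 + 506 / 100 * u)
      = (r + h) * ((1 - v) ^ 3 * (1 - u / 2) * (1 + 506 / 100 * u))" by (simp only: mult_ac)
  ultimately show "(r + h) * (1 + k) \<le> z * (1 + quot_error u * g)"
    unfolding X_def by linarith
  have "r' \<le> (1 + u) * r" using rr(2) v assms(3) mult_right_mono[of "1 + v" "1 + u" r] by linarith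
  then have ru: "r' \<le> (1 + u) * r" .
  then have "r' ^ 2 \<le> ((1 + u) * r) ^ 2" using r0 by (intro power_mono) auto
  moreover have "1 ^ 2 \<le> (1 + u) ^ 2" using u by (intro power_mono) auto
  ultimately have "1 + r' ^ 2 \<le> (1 + u) ^ 2 * h ^ 2"
    unfolding h(2) power_mult_distrib distrib_left by simp
  moreover have "(1 + u / 2) ^ 2 = 1 + u + u ^ 2 / 4" by (simp add: power2_eq_square field_simps)
  then have "1 + v \<le> (1 + u / 2) ^ 2" using v p by linarith
  ultimately have "(1 + v) * (1 + r' ^ 2) \<le> (1 + u / 2) ^ 2 * ((1 + u) ^ 2 * h ^ 2)"
    by (intro mult_mono) auto
  then have F: "t \<le> ((1 + u / 2) * ((1 + u) * h)) ^ 2" using tt by (simp add: power_mult_distrib)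
  have "sqrt t \<le> (1 + u / 2) * ((1 + u) * h)" by (rule real_le_lsqrt[OF _ F]) (use u h in auto)
  then have "(1 + v) * sqrt t \<le> (1 + u) * ((1 + u / 2) * ((1 + u) * h))"
    using u v t0 by (intro mult_mono) auto
  then have s2: "s \<le> (1 + u) ^ 2 * (1 + u / 2) * h" using ss by (simp add: field_simps power2_eq_square)
  have "1 * 1 \<le> (1 + u) * (1 + u / 2)" using u by (intro mult_mono) auto
  then have "1 * ((1 + u) * r) \<le> (1 + u) * (1 + u / 2) * ((1 + u) * r)"
    using u assms(3) by (intro mult_right_mono) auto
  then have "r' \<le> (1 + u) ^ 2 * (1 + u / 2) * r" using ru by (simp add: field_simps power2_eq_square)
  then have "r' + s \<le> (1 + u) ^ 2 * (1 + u / 2) * (r + h)" using s2 unfolding distrib_left[of "_ * _" r h] by linarith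
  then have "(1 + v) * (r' + s) \<le> (1 + u) * ((1 + u) ^ 2 * (1 + u / 2) * (r + h))"
    using u v r0 s0 by (intro mult_mono) auto
  then have "z \<le> (r + h) * ((1 + u) ^ 3 * (1 + u / 2))"
    using zz by (simp add: field_simps eval_nat_numeral)
  also have "\<dots> \<le> (r + h) * (1 + 406 / 100 * u)"
  proof (intro mult_left_mono)
    have "(1 + u) ^ 3 * (1 + u / 2) = 1 + 35 / 10 * u + 45 / 10 * u ^ 2 + 25 / 10 * u ^ 3 + 5 / 10 * u ^ 4"
      by (simp add: field_simps eval_nat_numeral)
    then show "(1 + u) ^ 3 * (1 + u / 2) \<le> 1 + 406 / 100 * u" using p u by linarith
  qed (use h assms(3) in auto)
  also have "\<dots> \<le> (r + h) * (1 + X * (1 + 2 * u) * g - k)"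
  proof (intro mult_left_mono)
    have "X * g * 1 \<le> X * g * (1 + 2 * u)" using Xg u by (intro mult_left_mono) auto
    then show "1 + 406 / 100 * u \<le> 1 + X * (1 + 2 * u) * g - k" using Xg k by (simp add: algebra_simps)
  qed (use h assms(3) in auto)
  finally show "z \<le> (r + h) * (1 + quot_error u * (1 + 2 * u) * g - k)" by (simp add: X_def)
qed

section \<open>The algorithm\<close>

lemma last_steps_error:
  fixes p :: nat and x y z :: real
  defines "u \<equiv> 2 powr - real p" and "r \<equiv> x / y" and "h \<equiv> sqrt (1 + (x / y) ^ 2)"
  defines "g \<equiv> h * (r + h) / (2 + sqrt 2)" and "k \<equiv> u - 2 * u ^ 2"
  assumes p: "p \<ge> 5" and y: "is_float p y" "0 < y" and x: "0 \<le> x"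
    and z: "is_float p z" "0 < z" and "1 \<le> g"
    and "(r + h) * (1 + k) \<le> z * (1 + quot_error u * g)"
    and "z \<le> (r + h) * (1 + quot_error u * (1 + 2 * u) * g - k)"
  shows "\<bar>RN p (x + RN p (y / z)) / sqrt (x ^ 2 + y ^ 2) - 1\<bar> \<le> phi u"
proof -
  have "2 powr - real p \<le> 2 powr - 5" using p by (intro powr_mono) auto
  then have u: "0 < u" "u \<le> 1/32" by (simp_all add: u_def powr_minus powr_numeral)
  have div: "\<bar>a / y - b / y\<bar> \<le> c * (d / y)" if "\<bar>a - b\<bar> \<le> c * d" for a b c d
    using that y by (simp add: divide_right_mono flip: diff_divide_distrib)
  define z2 where "z2 = RN p (y / z)"
  have "\<bar>z2 / y - y / z / y\<bar> \<le> k * (y / z / y)"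
    using RN_divide_error[of p y z] p y z unfolding z2_def k_def u_def by (intro div) auto
  then have zz: "\<bar>z2 / y - 1 / z\<bar> \<le> k * (1 / z)" using y by simp
  have "\<bar>RN p (x + z2) / y - (x + z2) / y\<bar> \<le> u / (1 + u) * (\<bar>x + z2\<bar> / y)"
    using RN_rel_error[of p "x + z2"] p unfolding u_def by (intro div) auto
  then have \<rho>: "\<bar>RN p (x + z2) / y - (r + z2 / y)\<bar> \<le> u / (1 + u) * \<bar>r + z2 / y\<bar>"
    using y by (simp add: r_def add_divide_distrib[symmetric])
  have "\<bar>RN p (x + z2) / y / h - 1\<bar> \<le> phi u"
    unfolding h_def r_def[symmetric]
    by (rule final_steps_error[OF u _ z(2) _ _ _ zz[unfolded k_def] \<rho>])
      (use assms in \<open>simp_all add: g_def h_def r_def k_def\<close>)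
  moreover have "y * h = sqrt (x ^ 2 + y ^ 2)"
  proof -
    have "y * h = sqrt (y ^ 2) * sqrt (1 + (x / y) ^ 2)" using y by (simp add: h_def)
    also have "\<dots> = sqrt (y ^ 2 * (1 + (x / y) ^ 2))" by (simp add: real_sqrt_mult)
    also have "y ^ 2 * (1 + (x / y) ^ 2) = x ^ 2 + y ^ 2" using y by (simp add: power_divide field_simps)
    finally show ?thesis .
  qed
  ultimately show ?thesis unfolding z2_def[symmetric] by (metis divide_divide_eq_left)
qed

lemma far_branch_error:
  fixes p :: nat and x y :: real
  defines "u \<equiv> 2 powr - real p"
  defines "r \<equiv> RN p (x / y)"
  defines "s \<equiv> RN p (sqrt (RN p (1 + r ^ 2)))"
  assumes p: "p \<ge> 5" and y: "is_float p y" "0 < y" and xy: "2 * y \<le> x"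
  shows "\<bar>RN p (x + RN p (y / RN p (r + s))) / sqrt (x ^ 2 + y ^ 2) - 1\<bar> \<le> phi u"
proof -
  have p1: "p \<ge> 1" using p by simp
  have "2 powr - real p \<le> 2 powr - 5" using p by (intro powr_mono) auto
  then have u: "0 < u" "u \<le> 1/32" by (simp_all add: u_def powr_minus powr_numeral)
  have r2: "2 \<le> x / y" using xy y by (simp add: pos_le_divide_eq)
  have fl: "is_float p 2" "is_float p 0" using is_float_of_int[of p 2] is_float_of_int[of p 0] p
    power_increasing[of 1 p "2::int"] by auto
  have "2 \<le> r" unfolding r_def by (rule RN_ge_float[OF p1 fl(1) r2])
  moreover have "0 \<le> s" unfolding s_def by (intro RN_nonneg p1 real_sqrt_ge_zero) simp
  ultimately have "2 \<le> RN p (r + s)" by (intro RN_ge_float[OF p1 fl(1)]) simp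
  then have z: "0 < RN p (r + s)" by simp
  note c = far_run[OF u r2 RN_rel_error[OF p1, of "x / y", folded u_def r_def]
      RN_rel_error[OF p1, of "1 + r ^ 2", folded u_def]
      RN_rel_error[OF p1, of "sqrt (RN p (1 + r ^ 2))", folded u_def s_def]
      RN_rel_error[OF p1, of "r + s", folded u_def]]
  have "0 \<le> x" using xy y by simp
  show ?thesis unfolding u_def
    by (rule last_steps_error[OF p y \<open>0 \<le> x\<close> RN_is_float[OF p1] z c[unfolded u_def]])
qed

lemma near_branch_error:
  fixes p :: nat and x y :: real
  defines "u \<equiv> 2 powr - real p"
  defines "Ph \<equiv> RN p (1 + sqrt 2)"
  defines "r2 \<equiv> RN p ((x - y) / y)"
  defines "r3 \<equiv> RN p (RN p (2 * r2) + r2 ^ 2)"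
  defines "d \<equiv> RN p (RN p (sqrt 2) + RN p (sqrt (RN p (2 + r3))))"
  defines "r6 \<equiv> RN p (RN p (RN p (1 + sqrt 2 - Ph) + RN p (r3 / d)) + r2)"
  assumes p: "p \<ge> 5" and y: "is_float p y" "0 < y" and \<delta>: "is_float p (x - y)" and xy: "y \<le> x" "x - y \<le> y"
  shows "\<bar>RN p (x + RN p (y / RN p (Ph + r6))) / sqrt (x ^ 2 + y ^ 2) - 1\<bar> \<le> phi u"
proof -
  have p1: "p \<ge> 1" using p by simp
  have "2 powr - real p \<le> 2 powr - 5" using p by (intro powr_mono) auto
  then have u: "0 < u" "u \<le> 1/32" by (simp_all add: u_def powr_minus powr_numeral)
  have "(2::int) ^ 5 \<le> 2 ^ p" using p by (intro power_increasing) auto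
  then have int_float: "is_float p (of_int M)" "is_float p (of_int M * 2 powr of_int e)"
    if "\<bar>M\<bar> \<le> 9" for M e :: int
    using that by (intro is_float_of_int is_float_intro p1; simp)+
  \<comment> \<open>The floats 3/2 and 9/4 will bound \<open>R2\<close> and \<open>s2\<close>. Their
    sum 15/4 is below 4, which gives the error 2 u for d.\<close>
  have fl: "is_float p 1" "is_float p 2" "is_float p 3" "is_float p 4" "is_float p 5"
    "is_float p (3 / 2)" "is_float p (9 / 4)"
    using int_float(1)[of 1] int_float(1)[of 2] int_float(1)[of 3] int_float(1)[of 4] int_float(1)[of 5]
      int_float(2)[of 3 "-1"] int_float(2)[of 9 "-2"] by (simp_all add: powr_minus powr_numeral)
  have abs_error: "\<bar>a\<bar> \<le> 2 \<Longrightarrow> \<bar>RN p a - a\<bar> \<le> u" "\<bar>a\<bar> \<le> 4 \<Longrightarrow> \<bar>RN p a - a\<bar> \<le> 2 * u"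
    "\<bar>a\<bar> \<le> 8 \<Longrightarrow> \<bar>RN p a - a\<bar> \<le> 4 * u" "\<bar>a\<bar> \<le> 2 * u \<Longrightarrow> \<bar>RN p a - a\<bar> \<le> u ^ 2" for a
    using RN_abs_error[OF p1, of a 0] RN_abs_error[OF p1, of a 1] RN_abs_error[OF p1, of a 2]
      RN_abs_error[OF p1, of a "- int p"]
    by (simp_all add: u_def powr_numeral power2_eq_square)
  note rel_error = RN_rel_error[OF p1, folded u_def]
  define w where "w = (x - y) / y"
  have w: "0 \<le> w" "w \<le> 1" using xy y by (auto simp: w_def)
  define Pl where "Pl = RN p (1 + sqrt 2 - Ph)"
  define R2 where "R2 = RN p (sqrt 2)"
  define r4 where "r4 = RN p (2 + r3)"
  define s2 where "s2 = RN p (sqrt r4)"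
  define q where "q = RN p (r3 / d)"
  define r5 where "r5 = RN p (Pl + q)"
  have Ph: "\<bar>1 + sqrt 2 - Ph\<bar> \<le> 2 * u"
    using abs_error(2)[of "1 + sqrt 2"] sqrt2_bounds by (simp add: Ph_def abs_minus_commute)
  have fu: "is_float p (2 * u)" "is_float p (- (2 * u))"
    using int_float(2)[of 2 "- int p"] int_float(2)[of "-2" "- int p"] by (simp_all add: u_def)
  have Pl: "\<bar>Pl\<bar> \<le> 2 * u"
    using RN_le_float[OF p1 fu(1), of "1 + sqrt 2 - Ph"] RN_ge_float[OF p1 fu(2), of "1 + sqrt 2 - Ph"] Ph
    by (auto simp: Pl_def abs_le_iff)
  have Pl': "\<bar>Ph + Pl - (1 + sqrt 2)\<bar> \<le> u ^ 2"
    using abs_error(4)[OF Ph] by (simp add: Pl_def algebra_simps)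
  have R2: "\<bar>R2 - sqrt 2\<bar> \<le> u" using abs_error(1)[of "sqrt 2"] sqrt2_bounds by (simp add: R2_def)
  have R2': "0 \<le> R2" "R2 \<le> 3 / 2"
    using RN_nonneg[OF p1, of "sqrt 2"] RN_le_float[OF p1 fl(6), of "sqrt 2"] sqrt2_bounds by (auto simp: R2_def)
  have r2: "\<bar>r2 - w\<bar> \<le> (u - 2 * u ^ 2) * w"
    using RN_divide_error[of p "x - y" y] p y \<delta> xy by (simp add: r2_def w_def u_def)
  have r2': "0 \<le> r2" "r2 \<le> 1" "is_float p r2"
    using RN_nonneg[OF p1, of w] RN_le_float[OF p1 fl(1), of w] w RN_is_float[OF p1]
    by (auto simp: r2_def w_def)
  have "RN p (2 * r2) = 2 * r2"
    using RN_float[OF p1 is_float_mult_powr[OF r2'(3), of 1]] by (simp add: mult.commute)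
  then have r3_eq: "r3 = RN p (2 * r2 + r2 ^ 2)" by (simp add: r3_def)
  have "r2 ^ 2 \<le> 1" using r2' by (simp add: power_le_one)
  then have r3': "0 \<le> r3" "r3 \<le> 3" unfolding r3_eq
    using r2' by (intro RN_nonneg[OF p1] RN_le_float[OF p1 fl(3)]; simp)+
  have r4': "2 \<le> r4" "r4 \<le> 5" unfolding r4_def
    using r3' by (intro RN_ge_float[OF p1 fl(2)] RN_le_float[OF p1 fl(5)]; simp)+
  have sr4: "sqrt 2 \<le> sqrt r4" "sqrt r4 \<le> 9 / 4"
    using r4' by (simp, intro real_le_lsqrt) (simp_all add: power_divide)
  have s2': "0 \<le> s2" "s2 \<le> 9 / 4" unfolding s2_def
    using sr4 r4' by (intro RN_nonneg[OF p1] RN_le_float[OF p1 fl(7)]; simp)+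
  have s2: "\<bar>s2 - sqrt r4\<bar> \<le> u * (1 + 171 / 100 * (sqrt r4 - sqrt 2))"
  proof (cases "sqrt r4 \<le> 2")
    case True
    have "u * 1 \<le> u * (1 + 171 / 100 * (sqrt r4 - sqrt 2))" using sr4 u by (intro mult_left_mono) auto
    then show ?thesis using abs_error(1)[of "sqrt r4"] True r4' by (simp add: s2_def)
  next
    case False
    then have "u * 2 \<le> u * (1 + 171 / 100 * (sqrt r4 - sqrt 2))"
      using sqrt2_bounds u by (intro mult_left_mono) auto
    then show ?thesis using abs_error(2)[of "sqrt r4"] sr4 r4' by (simp add: s2_def)
  qed
  have d: "\<bar>d - (R2 + s2)\<bar> \<le> 2 * u"
    unfolding d_def R2_def[symmetric] r4_def[symmetric] s2_def[symmetric]
    using R2' s2' by (intro abs_error) simp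
  have r3_error: "\<bar>r3 - (2 * r2 + r2 ^ 2)\<bar> \<le> u / (1 + u) * \<bar>2 * r2 + r2 ^ 2\<bar>"
    unfolding r3_eq by (rule rel_error)
  have r4_error: "\<bar>r4 - (2 + r3)\<bar> \<le> u / (1 + u) * \<bar>2 + r3\<bar>"
    unfolding r4_def by (rule rel_error)
  have q_error: "\<bar>q - r3 / d\<bar> \<le> u / (1 + u) * \<bar>r3 / d\<bar>"
    unfolding q_def by (rule rel_error)
  have r5_error: "\<bar>r5 - (Pl + q)\<bar> \<le> u / (1 + u) * \<bar>Pl + q\<bar>"
    unfolding r5_def by (rule rel_error)
  have "r6 = RN p (r5 + r2)" unfolding r6_def r5_def q_def Pl_def ..
  then have r6_error: "\<bar>r6 - (r5 + r2)\<bar> \<le> u / (1 + u) * \<bar>r5 + r2\<bar>"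
    using rel_error[of "r5 + r2"] by (simp only:)
  interpret near_one_run u w Ph Pl R2 r2 r3 r4 s2 d q r5 r6
    by unfold_locales (fact u w Pl' Pl R2 r2 r3_error r4_error s2 d q_error r5_error r6_error)+
  define z where "z = RN p (Ph + r6)"
  have z: "z0 * (1 + k) \<le> z * (1 + X * g)" "z \<le> z0 * (1 + X * (1 + 2 * u) * g - k)"
    unfolding z_def
    using abs_error(2,3)[of "Ph + r6"] RN_ge_float[OF p1 fl(4), of "Ph + r6"] Ph_r6_range(1,2)
    by (intro z_bounds; simp)+
  have r: "x / y = 1 + w" using y by (simp add: w_def field_simps)
  have h: "sqrt (1 + (x / y) ^ 2) = sqrt 2 + m" unfolding r by (rule sqrt_eq)
  have rh: "x / y + (sqrt 2 + m) = z0" unfolding r z0_def by simp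
  have z0: "0 < z0" using w m_bounds sqrt2_bounds unfolding z0_def by linarith
  have "0 < z0 * (1 + k)" "0 < 1 + X * g" using z0 k_bounds X_bounds g_bounds by (auto intro: mult_pos_pos add_pos_pos)
  then have "0 < z * (1 + X * g)" "0 < 1 + X * g" using z(1) by linarith+
  then have "0 < z" by (rule zero_less_mult_pos2)
  have zf: "is_float p z" unfolding z_def by (rule RN_is_float[OF p1])
  have x: "0 \<le> x" using xy y by simp
  note c = last_steps_error[OF p y x zf \<open>0 < z\<close>, folded u_def, unfolded h rh, folded g_def k_def X_def]
  show ?thesis unfolding z_def[symmetric] by (rule c[OF g_bounds(5) z])
qed

theorem theorem5:
  fixes p :: nat and x y :: real
  assumes "p \<ge> 5"
    and "is_float p x" and "is_float p y"
    and "0 \<le> y" and "y \<le> x" and "0 < x"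
  shows "\<bar>hypot_alg p x y / sqrt (x ^ 2 + y ^ 2) - 1\<bar> \<le> phi (2 powr - real p)
     \<and> (\<lambda>u. phi u - ((5 * sqrt 2 / 2 - 2) * u + (30 - 39 * sqrt 2 / 2) * u ^ 3))
          \<in> O[at 0](\<lambda>u. u ^ 4)
     \<and> (\<forall>u::real. 0 \<le> u \<and> u \<le> 1/32 \<longrightarrow> phi u \<le> (5 * sqrt 2 / 2 - 2) * u + u ^ 2 / 12)"
proof (intro conjI allI impI)
  have p: "p \<ge> 1" using assms(1) by simp
  show "\<bar>hypot_alg p x y / sqrt (x ^ 2 + y ^ 2) - 1\<bar> \<le> phi (2 powr - real p)"
  proof (cases "y = 0")
    case True
    \<comment> \<open>For y = 0 the first branch is taken, with x / 0 = 0 by convention. Whatever z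
      is, y / z = 0 and the output is x, so only \<open>phi\<close> >= 0 remains to be
      shown.\<close>
    have "2 powr - real p \<le> 2 powr - 5" using assms(1) by (intro powr_mono) auto
    then have u: "0 < 2 powr - real p" "2 powr - real p \<le> 1/32" by (simp_all add: powr_minus powr_numeral)
    have "0 \<le> quot_error (2 powr - real p)"
    proof -
      have "0 \<le> (2 * sqrt 2 - 1) * 2 powr - real p" using sqrt2_bounds by simp
      then show ?thesis using quot_error_bounds(1)[OF u] zero_le_power2[of "2 powr - real p"] by linarith
    qed
    then have "1 * 1 \<le> (1 + 2 powr - real p / (1 + 2 powr - real p)) * (1 + quot_error (2 powr - real p) / (2 + sqrt 2))"
      using u by (intro mult_mono) auto
    then have "0 \<le> phi (2 powr - real p)" unfolding phi_eq[OF u] by simp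
    moreover have "hypot_alg p x y = RN p (RN p x)"
    proof -
      have "RN p 0 = 0" by (simp add: RN_def)
      then show ?thesis using True assms RN_float[OF p assms(2)] by (simp add: hypot_alg_def Let_def)
    qed
    ultimately show ?thesis using True assms RN_float[OF p assms(2)] by simp
  next
    case False
    then have y: "0 < y" using assms(4) by simp
    show ?thesis
    proof (cases "RN p (x - y) > y")
      case True
      then have "2 * y \<le> x" using RN_diff_cases(2)[OF p assms(2,3) y assms(5)] by simp
      from far_branch_error[OF assms(1,3) y this] True show ?thesis
        by (simp add: hypot_alg_def Let_def)
    next
      case False
      then have \<delta>: "is_float p (x - y)" using RN_diff_cases(1)[OF p assms(2,3) y assms(5)] by simp
      then have "RN p (x - y) = x - y" by (rule RN_float[OF p])
      then show ?thesis using False near_branch_error[OF assms(1,3) y \<delta> assms(5)]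
        by (simp add: hypot_alg_def Let_def)
    qed
  qed
  show "(\<lambda>u. phi u - ((5 * sqrt 2 / 2 - 2) * u + (30 - 39 * sqrt 2 / 2) * u ^ 3)) \<in> O[at 0](\<lambda>u. u ^ 4)"
    by (rule phi_cubic_expansion)
  show "phi u \<le> (5 * sqrt 2 / 2 - 2) * u + u ^ 2 / 12" if "0 \<le> u \<and> u \<le> 1/32" for u :: real
    using that by (intro phi_quadratic_bound) auto
qed

end
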